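(* The Lie group $\mathrm{SU}(2)\times\mathbb{R}^{>0}$ is not Hessian; that is, there do not exist a left invariant affine structure $\nabla$ and a left invariant Riemannian metric $g$ on $\mathrm{SU}(2)\times\mathbb{R}^{>0}$ such that $(\mathrm{SU}(2)\times\mathbb{R}^{>0},\nabla,g)$ is a Hessian Lie group.
   Context: A left invariant affine structure on a Lie group is a left invariant flat torsion-free connection $\nabla$. A Hessian metric on a flat affine manifold $(M,\nabla)$ is a Riemannian metric locally of the form $\nabla d\varphi=\sum\frac{\partial^2\varphi}{\partial x^i\partial x^j}dx^idx^j$ in local flat coordinates. A Hessian Lie group $(G,\nabla,g)$ is a Lie group $G$ with a left invariant affine structure $\nabla$ and a left invariant metric $g$ that is Hessian with respect to $\nabla$. $\mathbb{R}^{>0}$ is the multiplicative group of positive reals. *)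

theory Defs
  imports "HOL-Analysis.Analysis" "HOL-Algebra.Group"
begin

section \<open>Smooth calculus on submanifolds of Euclidean space\<close>

text \<open>
  Throughout, \<open>M\<close> stands for a smooth embedded submanifold of a Euclidean space, given as a plain
  subset. Maps on \<open>M\<close> are total functions on the ambient type; only their values on \<open>M\<close> matter.
\<close>

fun Ck_on :: "nat \<Rightarrow> 'a set \<Rightarrow> ('a::euclidean_space \<Rightarrow> 'b::real_normed_vector) \<Rightarrow> bool" where
  "Ck_on 0 U f \<longleftrightarrow> continuous_on U f"
| "Ck_on (Suc k) U f \<longleftrightarrow>
     (\<forall>x\<in>U. f differentiable (at x)) \<and> (\<forall>v. Ck_on k U (\<lambda>x. frechet_derivative f (at x) v))"

text \<open>
  A map on a submanifold (or on a relatively open part \<open>S\<close> of one) is smooth iff it is locally the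
  restriction of a smooth map on an open subset of the ambient space.
\<close>

definition smooth_map :: "'a::euclidean_space set \<Rightarrow> ('a \<Rightarrow> 'b::real_normed_vector) \<Rightarrow> bool" where
  "smooth_map S f \<longleftrightarrow>
     (\<forall>p\<in>S. \<exists>U F. open U \<and> p \<in> U \<and> (\<forall>k. Ck_on k U F) \<and> (\<forall>x\<in>S \<inter> U. f x = F x))"

definition curve_through ::
    "'a::euclidean_space set \<Rightarrow> 'a \<Rightarrow> 'a \<Rightarrow> (real \<Rightarrow> 'a) \<Rightarrow> bool" where
  "curve_through M p v c \<longleftrightarrow>
     (\<forall>t. c t \<in> M) \<and> c 0 = p \<and> (c has_vector_derivative v) (at 0)"

text \<open>
  On an embedded submanifold it makes no difference whether the curves are smooth or merely
  differentiable at \<open>0\<close>.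
\<close>

definition tangent_space :: "'a::euclidean_space set \<Rightarrow> 'a \<Rightarrow> 'a set" where
  "tangent_space M p = {v. \<exists>c. curve_through M p v c}"

text \<open>
  The differential \<open>df\<^sub>p(v) = (f \<circ> c)'(0)\<close> for tangent vectors \<open>v\<close>. For smooth \<open>f\<close> the choice of the
  curve \<open>c\<close> is irrelevant, see \<open>tderiv_eq\<close> below.
\<close>

definition tderiv ::
    "'a::euclidean_space set \<Rightarrow> ('a \<Rightarrow> 'b::real_normed_vector) \<Rightarrow> 'a \<Rightarrow> 'a \<Rightarrow> 'b" where
  "tderiv M f p v = vector_derivative (\<lambda>t. f ((SOME c. curve_through M p v c) t)) (at 0)"

lemma tderiv_eq:
  assumes v: "v \<in> tangent_space M p" and U: "open U" "p \<in> U"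
    and F: "F differentiable (at p)" and eq: "\<And>x. x \<in> M \<inter> U \<Longrightarrow> f x = F x"
  shows "tderiv M f p v = frechet_derivative F (at p) v"
proof -
  define c where "c = (SOME c. curve_through M p v c)"
  have c: "curve_through M p v c"
    using v someI_ex[of "curve_through M p v"] unfolding tangent_space_def c_def by blast
  have cv: "(c has_vector_derivative v) (at 0)" and c0: "c 0 = p" and cM: "\<And>t. c t \<in> M"
    using c by (auto simp: curve_through_def)
  have "isCont c 0"
    using cv has_vector_derivative_continuous by blast
  then have "eventually (\<lambda>t. c t \<in> U) (nhds 0)"
    using U c0 by (simp add: continuous_at_open eventually_nhds)
  then have ev: "eventually (\<lambda>t. F (c t) = f (c t)) (nhds 0)"
    by eventually_elim (simp add: eq cM)
  have "(F has_derivative frechet_derivative F (at p)) (at (c 0))"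
    using F frechet_derivative_works c0 by blast
  then have "((F \<circ> c) has_vector_derivative frechet_derivative F (at p) v) (at 0)"
    using vector_derivative_diff_chain_within[of c v 0 UNIV F "frechet_derivative F (at p)"]
      cv has_derivative_at_withinI by blast
  then have "((\<lambda>t. f (c t)) has_vector_derivative frechet_derivative F (at p) v) (at 0)"
    using has_vector_derivative_cong_ev[of UNIV "F \<circ> c" "\<lambda>t. f (c t)" 0] ev eventually_nhds_x_imp_x[OF ev]
    by (simp add: o_def)
  then show ?thesis
    unfolding tderiv_def c_def[symmetric] by (rule vector_derivative_at)
qed

text \<open>Vector fields are normalised to vanish off \<open>M\<close>, so that equal fields are equal functions.\<close>

definition vector_fields :: "'a::euclidean_space set \<Rightarrow> ('a \<Rightarrow> 'a) set" where
  "vector_fields M =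
     {X. smooth_map M X \<and> (\<forall>p\<in>M. X p \<in> tangent_space M p) \<and> (\<forall>p. p \<notin> M \<longrightarrow> X p = 0)}"

definition vf_apply ::
    "'a::euclidean_space set \<Rightarrow> ('a \<Rightarrow> 'a) \<Rightarrow> ('a \<Rightarrow> real) \<Rightarrow> 'a \<Rightarrow> real" where
  "vf_apply M X f p = tderiv M f p (X p)"

text \<open>
  The commutator of derivations, \<open>[X, Y] f = X (Y f) - Y (X f)\<close>, written out for vector fields
  along a submanifold of Euclidean space: \<open>[X, Y] = dY(X) - dX(Y)\<close>.
\<close>

definition lie_bracket ::
    "'a::euclidean_space set \<Rightarrow> ('a \<Rightarrow> 'a) \<Rightarrow> ('a \<Rightarrow> 'a) \<Rightarrow> 'a \<Rightarrow> 'a" where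
  "lie_bracket M X Y p = (if p \<in> M then tderiv M Y p (X p) - tderiv M X p (Y p) else 0)"


section \<open>Connections, Riemannian metrics and Hessian metrics\<close>

type_synonym 'a conn = "('a \<Rightarrow> 'a) \<Rightarrow> ('a \<Rightarrow> 'a) \<Rightarrow> 'a \<Rightarrow> 'a"

definition connection :: "'a::euclidean_space set \<Rightarrow> 'a conn \<Rightarrow> bool" where
  "connection M nabla \<longleftrightarrow>
     (\<forall>X\<in>vector_fields M. \<forall>Y\<in>vector_fields M. nabla X Y \<in> vector_fields M) \<and>
     (\<forall>X\<in>vector_fields M. \<forall>X'\<in>vector_fields M. \<forall>Y\<in>vector_fields M.
        nabla (\<lambda>p. X p + X' p) Y = (\<lambda>p. nabla X Y p + nabla X' Y p)) \<and>
     (\<forall>X\<in>vector_fields M. \<forall>Y\<in>vector_fields M. \<forall>Y'\<in>vector_fields M.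
        nabla X (\<lambda>p. Y p + Y' p) = (\<lambda>p. nabla X Y p + nabla X Y' p)) \<and>
     (\<forall>f X Y. smooth_map M f \<and> X \<in> vector_fields M \<and> Y \<in> vector_fields M \<longrightarrow>
        nabla (\<lambda>p. f p *\<^sub>R X p) Y = (\<lambda>p. f p *\<^sub>R nabla X Y p)) \<and>
     (\<forall>f X Y. smooth_map M f \<and> X \<in> vector_fields M \<and> Y \<in> vector_fields M \<longrightarrow>
        nabla X (\<lambda>p. f p *\<^sub>R Y p) = (\<lambda>p. vf_apply M X f p *\<^sub>R Y p + f p *\<^sub>R nabla X Y p))"

definition torsion_free :: "'a::euclidean_space set \<Rightarrow> 'a conn \<Rightarrow> bool" where
  "torsion_free M nabla \<longleftrightarrow>
     (\<forall>X\<in>vector_fields M. \<forall>Y\<in>vector_fields M. \<forall>p.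
        nabla X Y p - nabla Y X p - lie_bracket M X Y p = 0)"

definition flat :: "'a::euclidean_space set \<Rightarrow> 'a conn \<Rightarrow> bool" where
  "flat M nabla \<longleftrightarrow>
     (\<forall>X\<in>vector_fields M. \<forall>Y\<in>vector_fields M. \<forall>Z\<in>vector_fields M. \<forall>p.
        nabla X (nabla Y Z) p - nabla Y (nabla X Z) p - nabla (lie_bracket M X Y) Z p = 0)"

definition riemannian_metric ::
    "'a::euclidean_space set \<Rightarrow> ('a \<Rightarrow> 'a \<Rightarrow> 'a \<Rightarrow> real) \<Rightarrow> bool" where
  "riemannian_metric M g \<longleftrightarrow>
     (\<forall>p\<in>M. \<forall>u\<in>tangent_space M p. \<forall>v\<in>tangent_space M p. \<forall>w\<in>tangent_space M p. \<forall>r.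
        g p u v = g p v u \<and>
        g p (u + v) w = g p u w + g p v w \<and>
        g p (r *\<^sub>R u) v = r * g p u v \<and>
        (u \<noteq> 0 \<longrightarrow> g p u u > 0)) \<and>
     (\<forall>X\<in>vector_fields M. \<forall>Y\<in>vector_fields M. smooth_map M (\<lambda>p. g p (X p) (Y p)))"

text \<open>
  The Hessian \<open>(\<nabla> d\<phi>)(X, Y) = X (Y \<phi>) - (\<nabla>\<^sub>X Y) \<phi>\<close>. In flat coordinates \<open>\<nabla>\<close> kills the coordinate
  fields, so its components there are the second partial derivatives of \<open>\<phi>\<close>.
\<close>

definition hessian ::
    "'a::euclidean_space set \<Rightarrow> 'a conn \<Rightarrow> ('a \<Rightarrow> real) \<Rightarrow> ('a \<Rightarrow> 'a) \<Rightarrow> ('a \<Rightarrow> 'a) \<Rightarrow> 'a \<Rightarrow> real"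
  where
  "hessian M nabla phi X Y p =
     vf_apply M X (vf_apply M Y phi) p - vf_apply M (nabla X Y) phi p"

text \<open>
  Tensors are determined at a point by globally defined vector fields, so testing the local identity
  \<open>g = \<nabla> d\<phi>\<close> on \<open>M \<inter> U\<close> against global fields \<open>X\<close>, \<open>Y\<close> is no restriction.
\<close>

definition hessian_metric ::
    "'a::euclidean_space set \<Rightarrow> 'a conn \<Rightarrow> ('a \<Rightarrow> 'a \<Rightarrow> 'a \<Rightarrow> real) \<Rightarrow> bool" where
  "hessian_metric M nabla g \<longleftrightarrow>
     riemannian_metric M g \<and>
     (\<forall>p\<in>M. \<exists>U phi. open U \<and> p \<in> U \<and> smooth_map (M \<inter> U) phi \<and>
        (\<forall>X\<in>vector_fields M. \<forall>Y\<in>vector_fields M. \<forall>q\<in>M \<inter> U.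
           g q (X q) (Y q) = hessian M nabla phi X Y q))"


section \<open>Left invariance and Hessian Lie groups\<close>

text \<open>
  \<open>G\<close> stands for a Lie group presented as a group whose carrier is an embedded submanifold of a
  Euclidean space and whose operations are smooth. These properties of \<open>G\<close> are presupposed, not
  repeated in the definitions; \<open>SU(2) \<times> \<real>\<^sup>>\<^sup>0\<close>, inside complex \<open>2 \<times> 2\<close> matrices times \<open>\<real>\<close>, has them.
\<close>

definition dL :: "'a::euclidean_space monoid \<Rightarrow> 'a \<Rightarrow> 'a \<Rightarrow> 'a \<Rightarrow> 'a" where
  "dL G a p v = tderiv (carrier G) (\<lambda>x. a \<otimes>\<^bsub>G\<^esub> x) p v"

definition L_push :: "'a::euclidean_space monoid \<Rightarrow> 'a \<Rightarrow> ('a \<Rightarrow> 'a) \<Rightarrow> 'a \<Rightarrow> 'a" where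
  "L_push G a X p =
     (if p \<in> carrier G
      then dL G a (inv\<^bsub>G\<^esub> a \<otimes>\<^bsub>G\<^esub> p) (X (inv\<^bsub>G\<^esub> a \<otimes>\<^bsub>G\<^esub> p)) else 0)"

definition left_invariant_connection :: "'a::euclidean_space monoid \<Rightarrow> 'a conn \<Rightarrow> bool" where
  "left_invariant_connection G nabla \<longleftrightarrow>
     (\<forall>a\<in>carrier G. \<forall>X\<in>vector_fields (carrier G). \<forall>Y\<in>vector_fields (carrier G).
        nabla (L_push G a X) (L_push G a Y) = L_push G a (nabla X Y))"

definition left_invariant_affine_structure :: "'a::euclidean_space monoid \<Rightarrow> 'a conn \<Rightarrow> bool" where
  "left_invariant_affine_structure G nabla \<longleftrightarrow>
     connection (carrier G) nabla \<and> flat (carrier G) nabla \<and> torsion_free (carrier G) nabla \<and>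
     left_invariant_connection G nabla"

definition left_invariant_metric ::
    "'a::euclidean_space monoid \<Rightarrow> ('a \<Rightarrow> 'a \<Rightarrow> 'a \<Rightarrow> real) \<Rightarrow> bool" where
  "left_invariant_metric G g \<longleftrightarrow>
     riemannian_metric (carrier G) g \<and>
     (\<forall>a\<in>carrier G. \<forall>p\<in>carrier G.
        \<forall>u\<in>tangent_space (carrier G) p. \<forall>v\<in>tangent_space (carrier G) p.
          g (a \<otimes>\<^bsub>G\<^esub> p) (dL G a p u) (dL G a p v) = g p u v)"

definition hessian_lie_group ::
    "'a::euclidean_space monoid \<Rightarrow> 'a conn \<Rightarrow> ('a \<Rightarrow> 'a \<Rightarrow> 'a \<Rightarrow> real) \<Rightarrow> bool" where
  "hessian_lie_group G nabla g \<longleftrightarrow>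
     left_invariant_affine_structure G nabla \<and> left_invariant_metric G g \<and>
     hessian_metric (carrier G) nabla g"


section \<open>The groups \<open>SU(2)\<close> and \<open>\<real>\<^sup>>\<^sup>0\<close>\<close>

definition conj_transpose :: "complex^'n^'m \<Rightarrow> complex^'m^'n" where
  "conj_transpose A = (\<chi> i j. cnj (A $ j $ i))"

definition SU2 :: "(complex^2^2) monoid" where
  "SU2 = \<lparr>carrier = {A. A ** conj_transpose A = mat 1 \<and> det A = 1}, mult = (**), one = mat 1\<rparr>"

definition pos_reals :: "real monoid" where
  "pos_reals = \<lparr>carrier = {0<..}, mult = (*), one = 1\<rparr>"

lemma conj_transpose_mult:
  "conj_transpose (A ** B) = conj_transpose B ** conj_transpose (A :: complex^'n^'m)"
  by (simp add: conj_transpose_def matrix_matrix_mult_def vec_eq_iff mult.commute)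

lemma conj_transpose_invol: "conj_transpose (conj_transpose A) = A"
  by (simp add: conj_transpose_def vec_eq_iff)

lemma conj_transpose_one: "conj_transpose (mat 1 :: complex^'n^'n) = mat 1"
  by (simp add: conj_transpose_def mat_def vec_eq_iff eq_commute)

lemma group_SU2: "group SU2"
proof (rule groupI)
  fix A B assume AB: "A \<in> carrier SU2" "B \<in> carrier SU2"
  have "(A ** B) ** (conj_transpose B ** conj_transpose A)
      = A ** (B ** conj_transpose B) ** conj_transpose A"
    by (simp add: matrix_mul_assoc)
  then show "A \<otimes>\<^bsub>SU2\<^esub> B \<in> carrier SU2"
    using AB by (simp add: SU2_def conj_transpose_mult det_mul)
next
  fix A assume A: "A \<in> carrier SU2"
  then have l: "conj_transpose A ** A = mat 1"
    by (simp add: SU2_def matrix_left_right_inverse)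
  from arg_cong[OF this, of det] A have "det (conj_transpose A) = 1"
    by (simp add: SU2_def det_mul)
  with l show "\<exists>B\<in>carrier SU2. B \<otimes>\<^bsub>SU2\<^esub> A = \<one>\<^bsub>SU2\<^esub>"
    by (intro bexI[of _ "conj_transpose A"]) (auto simp: SU2_def conj_transpose_invol)
qed (auto simp: SU2_def conj_transpose_one matrix_mul_assoc)

lemma group_pos_reals: "group pos_reals"
proof (rule groupI)
  fix x assume "x \<in> carrier pos_reals"
  then show "\<exists>y\<in>carrier pos_reals. y \<otimes>\<^bsub>pos_reals\<^esub> x = \<one>\<^bsub>pos_reals\<^esub>"
    by (intro bexI[of _ "inverse x"]) (auto simp: pos_reals_def)
qed (auto simp: pos_reals_def)

lemma group_SU2_pos_reals: "group (SU2 \<times>\<times> pos_reals)"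
  by (rule DirProd_group[OF group_SU2 group_pos_reals])

end

theory Submission
  imports Defs "Jordan_Normal_Form.Schur_Decomposition"
begin

text \<open>
  A left invariant Hessian structure is determined by its values at the identity. There the
  connection gives a product \<open>x \<cdot> y = \<nabla>\<^sub>x y\<close> on the Lie algebra \<open>su(2) \<oplus> \<real>\<close> and the metric an inner
  product \<open>h\<close>. Vanishing torsion and curvature say that \<open>x \<cdot> y - y \<cdot> x = [x, y]\<close> and that the left
  multiplications \<open>L\<^sub>x\<close> form a representation of the Lie algebra. Differentiating
  \<open>g = \<nabla> d\<phi>\<close> along left invariant fields gives the Codazzi equation
  \<open>h([x, y], z) = h(x, y \<cdot> z) - h(y, x \<cdot> z)\<close>, since the terms with derivatives of \<open>\<phi>\<close> cancel by
  flatness. The theorem thus reduces to the algebraic statement \<open>no_hessian_algebra\<close>: no such pair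
  \<open>(\<cdot>, h)\<close> exists on the four-dimensional algebra \<open>su(2) \<oplus> \<real>\<close>.

  Compactness enters through the Casimir operator \<open>C = L\<^sub>1\<^sup>2 + L\<^sub>2\<^sup>2 + L\<^sub>3\<^sup>2\<close> of the representation of
  \<open>su(2)\<close>. In every finite-dimensional real representation \<open>C\<close> has trace at most \<open>0\<close>, because
  \<open>\<i> L\<^sub>3\<close> has only real eigenvalues (\<open>trace_square_nonpos\<close>), and a nonzero kernel of \<open>C\<close> contains a
  nonzero vector that \<open>su(2)\<close> annihilates (\<open>invariant_vector_in_casimir_kernel\<close>). Both follow from
  the ladder operator argument.

  If \<open>C\<close> were singular, an invariant vector of the dual representation would show that
  \<open>su(2) \<cdot> (su(2) \<oplus> \<real>)\<close> lies in \<open>su(2)\<close>. A further invariant vector in \<open>su(2)\<close> is excluded by the Codazzi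
  equation, hence \<open>C\<close> is invertible on \<open>su(2)\<close>; solving \<open>C u = e\<^sub>1 \<cdot> e\<^sub>1 + e\<^sub>2 \<cdot> e\<^sub>2 + e\<^sub>3 \<cdot> e\<^sub>3\<close> yields
  \<open>u \<in> su(2)\<close> with \<open>x \<cdot> u = x\<close> for \<open>x \<in> su(2)\<close>, and then \<open>L\<^sub>u\<close> has trace \<open>3\<close>, although elements of
  \<open>su(2) = [su(2), su(2)]\<close> act with trace \<open>0\<close> (\<open>casimir_regular\<close>).

  If \<open>C\<close> is invertible, the same equation \<open>C u = q\<close> gives a right identity \<open>u\<close>, and \<open>C\<close> is right
  multiplication by \<open>q\<close>. Dually, the Codazzi equation gives a linear form \<open>\<psi>\<close> with
  \<open>\<psi>(x \<cdot> z) = h(x, z)\<close>. It vanishes on commutators, that is on \<open>su(2)\<close>, and so does the trace of right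
  multiplication; hence the two forms are proportional. They are positive at \<open>u\<close>, where their values
  are \<open>h(u, u)\<close> and \<open>4\<close>. As \<open>\<psi>(q) = \<Sum> h(e\<^sub>i, e\<^sub>i) > 0\<close>, also \<open>C\<close> has positive trace, a contradiction.
\<close>


section \<open>Traces of squares of matrices with real spectrum\<close>

lemma trace_square_similar:
  fixes A B P Q :: "complex mat"
  assumes A: "A \<in> carrier_mat n n" and sim: "similar_mat_wit A B P Q"
  shows "(\<Sum>i<n. (A * A) $$ (i,i)) = (\<Sum>i<n. (B * B) $$ (i,i))"
proof -
  have c: "B \<in> carrier_mat n n" "P \<in> carrier_mat n n" "Q \<in> carrier_mat n n"
     and QP: "Q * P = 1\<^sub>m n" and AB: "A = P * B * Q"
    using similar_mat_witD2[OF A sim] by auto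
  have "A * A = P * B * (Q * P) * (B * Q)"
    unfolding AB using c by (simp add: assoc_mult_mat[where n\<^sub>1=n and n\<^sub>2=n and n\<^sub>3=n and n\<^sub>4=n])
  also have "\<dots> = P * (B * B * Q)"
    unfolding QP using c by (simp add: assoc_mult_mat[where n\<^sub>1=n and n\<^sub>2=n and n\<^sub>3=n and n\<^sub>4=n])
  finally have AA: "A * A = P * (B * B * Q)" .
  have trc: "(\<Sum>i<n. (X * Y) $$ (i,i)) = (\<Sum>i<n. (Y * X) $$ (i,i))"
    if "X \<in> carrier_mat n n" "Y \<in> carrier_mat n n" for X Y :: "complex mat"
  proof -
    have "(\<Sum>i<n. (X * Y) $$ (i,i)) = (\<Sum>i<n. \<Sum>j<n. X $$ (i,j) * Y $$ (j,i))"
      using that by (auto simp: scalar_prod_def atLeast0LessThan intro!: sum.cong)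
    also have "\<dots> = (\<Sum>j<n. \<Sum>i<n. Y $$ (j,i) * X $$ (i,j))"
      by (subst sum.swap) (simp add: mult.commute)
    also have "\<dots> = (\<Sum>i<n. (Y * X) $$ (i,i))"
      using that by (auto simp: scalar_prod_def atLeast0LessThan intro!: sum.cong)
    finally show ?thesis .
  qed
  have "(\<Sum>i<n. (A * A) $$ (i,i)) = (\<Sum>i<n. (B * B * (Q * P)) $$ (i,i))"
    unfolding AA by (subst trc) (use c in \<open>auto simp: assoc_mult_mat[where n\<^sub>1=n and n\<^sub>2=n and n\<^sub>3=n and n\<^sub>4=n]\<close>)
  then show ?thesis unfolding QP using c by simp
qed

text \<open>
  In Schur form the diagonal entries of \<open>A\<^sup>2\<close> are the squares of the eigenvalues of \<open>A\<close>.
\<close>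

lemma mat_trace_square_nonneg:
  fixes A :: "complex mat"
  assumes A: "A \<in> carrier_mat n n" and real: "\<And>k. eigenvalue A k \<Longrightarrow> k \<in> \<real>"
  shows "Re (\<Sum>i<n. (A * A) $$ (i,i)) \<ge> 0"
proof -
  obtain es where es: "char_poly A = (\<Prod>a\<leftarrow>es. [:- a, 1:])"
    using char_poly_factorized[OF A] by auto
  obtain B P Q where BPQ: "schur_decomposition A es = (B,P,Q)" by (cases "schur_decomposition A es")
  have sim: "similar_mat_wit A B P Q" and ut: "upper_triangular B" and dg: "diag_mat B = es"
    using schur_decomposition[OF A es BPQ] by auto
  have B: "B \<in> carrier_mat n n" using similar_mat_witD2[OF A sim] by auto
  have "(B * B) $$ (i,i) = (B $$ (i,i))\<^sup>2" if "i < n" for i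
  proof -
    have "(B * B) $$ (i,i) = (\<Sum>j<n. B $$ (i,j) * B $$ (j,i))"
      using that B by (auto simp: scalar_prod_def atLeast0LessThan intro!: sum.cong)
    also have "\<dots> = (\<Sum>j\<in>{i}. B $$ (i,j) * B $$ (j,i))"
    proof (rule sum.mono_neutral_right)
      show "\<forall>j\<in>{..<n} - {i}. B $$ (i,j) * B $$ (j,i) = 0"
      proof
        fix j assume "j \<in> {..<n} - {i}"
        then consider "j < i" | "i < j" "j < n" by fastforce
        then show "B $$ (i,j) * B $$ (j,i) = 0"
          using ut B that unfolding upper_triangular_def by cases auto
      qed
    qed (use that in auto)
    finally show ?thesis by (simp add: power2_eq_square)
  qed
  moreover have "B $$ (i,i) \<in> \<real>" if "i < n" for i
  proof -
    have "B $$ (i,i) \<in> set es" using that B dg by (auto simp: diag_mat_def)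
    then have "poly (char_poly A) (B $$ (i,i)) = 0"
      unfolding es by (simp add: poly_prod_list prod_list_zero_iff image_iff)
    then show ?thesis using eigenvalue_root_char_poly[OF A] real by blast
  qed
  ultimately have "Re ((B * B) $$ (i,i)) \<ge> 0" if "i < n" for i
    using that by (metis Reals_cases Re_complex_of_real of_real_power zero_le_power2)
  then show ?thesis
    unfolding trace_square_similar[OF A sim] by (auto intro!: sum_nonneg simp del: index_mult_mat)
qed

text \<open>
  From here on \<open>$\<close>, \<open>mat\<close> and their companions refer to matrices over finite index types.
\<close>

no_notation Matrix.vec_index (infixl "$" 100)
no_notation Matrix.scalar_prod (infix "\<bullet>" 70)
hide_const (open) Matrix.mat Matrix.vec Matrix.row Matrix.col Matrix.rows Matrix.cols
  Module.smult VectorSpace.subspace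
hide_fact (open) Matrix.vec_eq_iff Matrix.mat_def

text \<open>
  The transfer of the preceding lemma along an enumeration of the index type.
\<close>

lemma trace_square_nonneg:
  fixes M :: "complex^'n^'n"
  assumes real: "\<And>k v. v \<noteq> 0 \<Longrightarrow> M *v v = k *s v \<Longrightarrow> k \<in> \<real>"
  shows "Re (trace (M ** M)) \<ge> 0"
proof -
  define N where "N = CARD('n)"
  obtain f where f: "bij_betw f {..<N} (UNIV :: 'n set)"
    using ex_bij_betw_nat_finite[of "UNIV :: 'n set"] by (auto simp: N_def atLeast0LessThan)
  define A where "A = Matrix.mat N N (\<lambda>(i,j). M $ f i $ f j)"
  have A: "A \<in> carrier_mat N N" by (simp add: A_def)
  have s: "(\<Sum>j<N. g (f j)) = (\<Sum>x\<in>UNIV. g x)" for g :: "'n \<Rightarrow> complex"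
    by (rule sum.reindex_bij_betw[OF f])
  have "k \<in> \<real>" if ev: "eigenvalue A k" for k
  proof -
    obtain w where w: "w \<in> carrier_vec N" "w \<noteq> 0\<^sub>v N" "A *\<^sub>v w = k \<cdot>\<^sub>v w"
      using ev A by (auto simp: eigenvalue_def eigenvector_def)
    define v :: "complex^'n" where "v = (\<chi> x. vec_index w (inv_into {..<N} f x))"
    have vf: "v $ f i = vec_index w i" if "i < N" for i
      using that f by (simp add: v_def bij_betw_def inv_into_f_f)
    have "v \<noteq> 0"
    proof
      assume "v = 0"
      then have "w = 0\<^sub>v N" using w vf by (intro eq_vecI) (auto simp: vec_eq_iff)
      then show False using w by simp
    qed
    moreover have "M *v v = k *s v"
    proof -
      have "(M *v v) $ f i = (k *s v) $ f i" if i: "i < N" for i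
      proof -
        have "(M *v v) $ f i = (\<Sum>j<N. M $ f i $ f j * v $ f j)"
          by (simp add: matrix_vector_mult_def s[of "\<lambda>x. M $ f i $ x * v $ x"])
        also have "\<dots> = vec_index (A *\<^sub>v w) i"
          using i w(1) by (auto simp: A_def scalar_prod_def vf atLeast0LessThan intro!: sum.cong)
        finally show ?thesis unfolding w(3) using w(1) i vf by simp
      qed
      moreover have "\<exists>i<N. x = f i" for x
        using f by (auto simp: bij_betw_def image_iff)
      ultimately show ?thesis unfolding Finite_Cartesian_Product.vec_eq_iff by metis
    qed
    ultimately show ?thesis using real by blast
  qed
  from mat_trace_square_nonneg[OF A this]
  have "0 \<le> Re (\<Sum>i<N. (A * A) $$ (i,i))" .
  also have "(\<Sum>i<N. (A * A) $$ (i,i)) = (\<Sum>i<N. \<Sum>j<N. M $ f i $ f j * M $ f j $ f i)"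
    by (auto simp: A_def scalar_prod_def atLeast0LessThan intro!: sum.cong)
  also have "\<dots> = trace (M ** M)"
    unfolding trace_def matrix_matrix_mult_def
    by (simp add: s[of "\<lambda>y. M $ f i $ y * M $ y $ f i" for i] s[of "\<lambda>x. \<Sum>j\<in>UNIV. M $ x $ j * M $ j $ x"])
  finally show ?thesis .
qed

section \<open>Representations of su(2)\<close>

text \<open>
  More than \<open>DIM('a)\<close> vectors are dependent. If two of the iterates coincide, the relation is their
  difference; this case is separate because dependence is a notion for sets of vectors.
\<close>

lemma iterates_dependent:
  fixes f :: "'a::euclidean_space \<Rightarrow> 'a"
  shows "\<exists>n a. (\<exists>i<n. a i \<noteq> 0) \<and> (\<Sum>i<n. a i *\<^sub>R (f ^^ i) v) = (0::'a)"
proof -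
  define n where "n = DIM('a) + 1"
  define g where "g i = (f ^^ i) v" for i
  show ?thesis
  proof (cases "inj_on g {..<n}")
    case False
    then obtain i j where ij: "i < n" "j < n" "i \<noteq> j" "g i = g j" by (auto simp: inj_on_def)
    define a :: "nat \<Rightarrow> real" where "a k = (if k = i then 1 else if k = j then -1 else 0)" for k
    have "(\<Sum>k<n. a k *\<^sub>R g k) = (\<Sum>k\<in>{i,j}. a k *\<^sub>R g k)"
      using ij by (intro sum.mono_neutral_right) (auto simp: a_def)
    also have "\<dots> = 0" using ij by (simp add: a_def)
    finally show ?thesis using ij unfolding g_def by (intro exI[of _ n] exI[of _ a]) (auto simp: a_def)
  next
    case True
    have "card (g ` {..<n}) = n" using True by (simp add: card_image)
    then have "dependent (g ` {..<n})"
      using independent_bound[of "g ` {..<n}"] by (auto simp: n_def)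
    then obtain u where u: "\<exists>x\<in>g ` {..<n}. u x \<noteq> 0" "(\<Sum>x\<in>g ` {..<n}. u x *\<^sub>R x) = 0"
      using dependent_finite[of "g ` {..<n}"] by auto
    have "(\<Sum>i<n. u (g i) *\<^sub>R g i) = 0"
      using u(2) by (simp add: sum.reindex[OF True])
    then show ?thesis using u(1) unfolding g_def by (intro exI[of _ n] exI[of _ "\<lambda>i. u (g i)"]) (auto simp: g_def)
  qed
qed

text \<open>
  The value \<open>p(M) v\<close> by Horner's scheme, which makes induction on \<open>p\<close> immediate.
\<close>

definition poly_act :: "complex^'n^'n \<Rightarrow> complex poly \<Rightarrow> complex^'n \<Rightarrow> complex^'n" where
  "poly_act M p v = fold_coeffs (\<lambda>a w. a *s v + M *v w) p 0"

lemma poly_act_0 [simp]: "poly_act M 0 v = 0"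
  by (simp add: poly_act_def)

lemma poly_act_pCons [simp]: "poly_act M (pCons a p) v = a *s v + M *v poly_act M p v"
  by (cases "p = 0 \<and> a = 0") (auto simp: poly_act_def)

lemma poly_act_add: "poly_act M (p + q) v = poly_act M p v + poly_act M q v"
  by (induction p q rule: poly_induct2)
     (simp_all add: matrix_vector_right_distrib vector_sadd_rdistrib algebra_simps)

lemma poly_act_smult: "poly_act M (smult c p) v = c *s poly_act M p v"
  by (induction p) (simp_all add: vector_add_ldistrib vector_scalar_commute vector_smult_assoc)

lemma poly_act_shift: "poly_act M p (M *v v - z *s v) = poly_act M ([:-z, 1:] * p) v"
proof -
  have "poly_act M p (M *v v - z *s v) = M *v poly_act M p v - z *s poly_act M p v"
  proof (induction p)
    case (pCons a p)
    then show ?case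
      by (simp only: poly_act_pCons matrix_vector_right_distrib matrix_vector_mult_diff_distrib vector_scalar_commute)
        (simp add: vec_eq_iff algebra_simps)
  qed simp
  moreover have "[:-z, 1:] * p = smult (-z) p + pCons 0 p" by simp
  ultimately show ?thesis
    by (simp only: poly_act_add poly_act_smult poly_act_pCons) (simp add: vec_eq_iff)
qed

lemma poly_act_monom: "poly_act M (monom a i) v = a *s (((*v) M ^^ i) v)"
  by (induction i) (simp_all add: monom_Suc monom_0 vector_scalar_commute)

lemma poly_act_eigenvector:
  assumes "M *v v = k *s v"
  shows "poly_act M p v = poly p k *s v"
  by (induction p) (simp_all add: assms vector_scalar_commute vector_smult_assoc vector_sadd_rdistrib mult.commute)

lemma vec_scaleR_eq: "r *\<^sub>R (v :: complex^'n) = complex_of_real r *s v"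
  by (simp add: vec_eq_iff scaleR_conv_of_real[of r "_ :: complex"])

lemma sum_monom_nonzero:
  assumes "i < n" "a i \<noteq> 0"
  shows "(\<Sum>j<n. monom (a j) j) \<noteq> 0"
proof -
  have "coeff (\<Sum>j<n. monom (a j) j) i = (\<Sum>j<n. if j = i then a j else 0)"
    by (simp add: coeff_sum)
  also have "\<dots> = a i" using assms by simp
  finally show ?thesis using assms by auto
qed

lemma poly_act_sum: "finite I \<Longrightarrow> poly_act M (\<Sum>i\<in>I. p i) v = (\<Sum>i\<in>I. poly_act M (p i) v)"
  by (induction I rule: finite_induct) (simp_all add: poly_act_add)

text \<open>
  The relation among the powers of \<open>M\<close> has real coefficients, because the matrices are taken as a real vector
  space; it is then read as a complex polynomial.
\<close>

lemma annihilating_poly: "\<exists>p. p \<noteq> 0 \<and> (\<forall>v. poly_act M p v = 0)"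
proof -
  obtain n a i where a: "i < n" "a i \<noteq> 0" "(\<Sum>i<n. a i *\<^sub>R ((**) M ^^ i) (mat 1)) = 0"
    using iterates_dependent[of "(**) M" "mat 1"] by blast
  have it: "((**) M ^^ i) (mat 1) *v v = ((*v) M ^^ i) v" for i v
    by (induction i) (simp_all flip: matrix_vector_mul_assoc)
  have "(\<Sum>i<n. a i *\<^sub>R ((*v) M ^^ i) v) = 0" for v
  proof -
    have "(\<Sum>i<n. a i *\<^sub>R ((*v) M ^^ i) v) = (\<Sum>i<n. (a i *\<^sub>R ((**) M ^^ i) (mat 1)) *v v)"
      by (simp add: it[symmetric] vec_eq_iff matrix_vector_mult_def scaleR_sum_right)
    also have "\<dots> = (\<Sum>i<n. a i *\<^sub>R ((**) M ^^ i) (mat 1)) *v v"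
      by (induction n) (simp_all add: matrix_vector_mult_add_rdistrib)
    finally show ?thesis using a by simp
  qed
  then have "poly_act M (\<Sum>j<n. monom (complex_of_real (a j)) j) v = 0" for v
    by (simp add: poly_act_sum poly_act_monom vec_scaleR_eq)
  then show ?thesis
    using sum_monom_nonzero[of i n "\<lambda>j. complex_of_real (a j)"] a by auto
qed

text \<open>
  All eigenvalues are roots of one annihilating polynomial.
\<close>

lemma finite_eigenvalues: "finite {k. \<exists>v. v \<noteq> 0 \<and> M *v v = k *s (v :: complex^'n)}"
proof -
  obtain p where p: "p \<noteq> 0" "\<And>v. poly_act M p v = 0" using annihilating_poly[of M] by blast
  have "{k. \<exists>v. v \<noteq> 0 \<and> M *v v = k *s (v :: complex^'n)} \<subseteq> {k. poly p k = 0}"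
    using p(2) poly_act_eigenvector[of M _ _ p] by (auto simp: vector_mul_eq_0)
  then show ?thesis using poly_roots_finite[OF p(1)] finite_subset by blast
qed

text \<open>
  Splitting off linear factors of a polynomial that annihilates \<open>v\<close>, one after another, either
  reaches an eigenvector or a constant polynomial, which annihilates no nonzero vector. All vectors
  met on the way stay in \<open>T\<close>, so that the eigenvector can be found inside an invariant subspace.
\<close>

lemma eigenvector_in_invariant_set:
  assumes v: "v \<in> T" "v \<noteq> 0"
    and T: "\<And>x z. x \<in> T \<Longrightarrow> M *v x - z *s x \<in> T"
  obtains w k where "w \<in> T" "w \<noteq> 0" "M *v w = k *s (w :: complex^'n)"
proof -
  have "\<exists>w k. w \<in> T \<and> w \<noteq> 0 \<and> M *v w = k *s w"
    if "p \<noteq> 0" "poly_act M p v = 0" "v \<in> T" "v \<noteq> 0" for p v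
    using that
  proof (induction "degree p" arbitrary: p v)
    case 0
    then obtain c where "p = [:c:]" by (metis degree_eq_zeroE)
    with 0 show ?case by auto
  next
    case (Suc d)
    then obtain z where "poly p z = 0"
      using fundamental_theorem_of_algebra[of p] constant_degree[of p] by auto
    then obtain q where q: "p = [:-z, 1:] * q" by (auto simp: poly_eq_0_iff_dvd)
    have "q \<noteq> 0" using Suc q by auto
    have d: "d = degree q" using Suc(2) \<open>q \<noteq> 0\<close> unfolding q by (subst (asm) degree_mult_eq) auto
    have 0: "poly_act M q (M *v v - z *s v) = 0" using Suc.prems q poly_act_shift by metis
    show ?case
    proof (cases "M *v v - z *s v = 0")
      case True
      then show ?thesis using Suc.prems by auto
    next
      case False
      then show ?thesis using Suc(1)[OF d \<open>q \<noteq> 0\<close> 0] Suc.prems T by blast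
    qed
  qed
  then show ?thesis using annihilating_poly[of M] v that by blast
qed

text \<open>
  \<open>H\<close>, \<open>P\<close>, \<open>N\<close> play the roles of \<open>J\<^sub>3\<close>, \<open>J\<^sub>+\<close>, \<open>J\<^sub>-\<close> of an angular momentum. The operator \<open>cas\<close> below is
  the total angular momentum squared, whose two expressions through \<open>P\<close> and \<open>N\<close> give its value on
  highest and on lowest weight vectors.
\<close>

locale ladder =
  fixes H P N :: "complex^'n^'n"
  assumes HP: "\<And>x. H *v (P *v x) = P *v (H *v x) + P *v x"
    and HN: "\<And>x. H *v (N *v x) = N *v (H *v x) - N *v x"
    and PN: "\<And>x. P *v (N *v x) = N *v (P *v x) + 2 *s (H *v x)"
begin

definition cas :: "complex^'n \<Rightarrow> complex^'n" where
  "cas x = N *v (P *v x) + H *v (H *v x) + H *v x"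

lemma cas_alt: "cas x = P *v (N *v x) + H *v (H *v x) - H *v x"
  by (simp add: cas_def PN vec_eq_iff)

lemma cas_N: "cas (N *v x) = N *v cas x"
proof -
  have "cas (N *v x) = N *v (P *v (N *v x)) + H *v (H *v (N *v x)) + H *v (N *v x)"
    by (simp add: cas_def)
  also have "\<dots> = N *v (P *v (N *v x) + H *v (H *v x) - H *v x)"
    by (simp add: HN matrix_vector_right_distrib matrix_vector_mult_diff_distrib)
  finally show ?thesis by (simp add: cas_alt)
qed

text \<open>
  An operator that shifts eigenvalues of \<open>H\<close> by a fixed \<open>c \<noteq> 0\<close> kills every eigenvector after finitely
  many steps, since \<open>H\<close> has finitely many eigenvalues. It is used with \<open>P\<close> (\<open>c = 1\<close>) and \<open>N\<close> (\<open>c = -1\<close>).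
\<close>

lemma chain_ends:
  assumes v: "v \<noteq> 0" "H *v v = \<mu> *s v"
    and X: "\<And>x. H *v (X *v x) = X *v (H *v x) + c *s (X *v x)" and c: "c \<noteq> 0"
  obtains k where "((*v) X ^^ k) v \<noteq> 0" "X *v ((*v) X ^^ k) v = 0"
    "H *v ((*v) X ^^ k) v = (\<mu> + of_nat k * c) *s ((*v) X ^^ k) v"
proof -
  define w where "w k = ((*v) X ^^ k) v" for k
  have Hw: "H *v w k = (\<mu> + of_nat k * c) *s w k" for k
    by (induction k) (simp_all add: w_def v X vector_scalar_commute vector_sadd_rdistrib algebra_simps)
  have "\<exists>k. w k = 0"
  proof (rule ccontr)
    assume "\<not> ?thesis"
    then have "range (\<lambda>k. \<mu> + of_nat k * c) \<subseteq> {k. \<exists>v. v \<noteq> 0 \<and> H *v v = k *s v}"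
      using Hw by blast
    then have "finite (range (\<lambda>k::nat. \<mu> + of_nat k * c))"
      using finite_eigenvalues finite_subset by blast
    moreover have "inj (\<lambda>k::nat. \<mu> + of_nat k * c)" using c by (auto simp: inj_def)
    ultimately show False using finite_imageD infinite_UNIV_nat by blast
  qed
  define k where "k = (LEAST k. w k = 0)"
  have k0: "w k = 0" unfolding k_def using \<open>\<exists>k. w k = 0\<close> by (rule LeastI_ex)
  then obtain j where j: "k = Suc j" using v by (cases k) (auto simp: w_def)
  have "w j \<noteq> 0" using not_less_Least[of j "\<lambda>k. w k = 0"] j k_def by auto
  moreover have "X *v w j = 0" using k0 j by (simp add: w_def)
  ultimately show ?thesis using that Hw unfolding w_def by blast
qed

text \<open>
  Lowering \<open>w\<close> until the next step gives \<open>0\<close> reaches a lowest weight vector of weight \<open>\<mu> - k\<close>. The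
  operator \<open>cas\<close> has the same eigenvalue there as on \<open>w\<close>, so \<open>\<mu> (\<mu> + 1) = (\<mu> - k) (\<mu> - k - 1)\<close>, which
  forces \<open>2 \<mu> = k\<close>.
\<close>

lemma highest_weight:
  assumes w: "w \<noteq> 0" "H *v w = \<mu> *s w" "P *v w = 0"
  obtains k :: nat where "\<mu> = of_nat k / 2" "k = 0 \<Longrightarrow> N *v w = 0"
proof -
  have "H *v (N *v x) = N *v (H *v x) + (-1) *s (N *v x)" for x
    by (simp add: HN vec_eq_iff)
  from chain_ends[OF w(1,2) this] obtain k where
    k: "((*v) N ^^ k) w \<noteq> 0" "N *v ((*v) N ^^ k) w = 0"
       "H *v ((*v) N ^^ k) w = (\<mu> + of_nat k * (-1)) *s ((*v) N ^^ k) w"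
    by auto
  have "cas w = (\<mu> * (\<mu> + 1)) *s w"
    by (simp add: cas_def w vector_scalar_commute vec_eq_iff algebra_simps)
  then have "cas (((*v) N ^^ k) w) = (\<mu> * (\<mu> + 1)) *s ((*v) N ^^ k) w"
  proof (induction k)
    case (Suc k)
    then show ?case by (simp add: cas_N vector_scalar_commute)
  qed simp
  moreover have "cas (((*v) N ^^ k) w) = ((\<mu> - of_nat k) * (\<mu> - of_nat k - 1)) *s ((*v) N ^^ k) w"
    by (simp add: cas_alt k vector_scalar_commute vec_eq_iff algebra_simps)
  ultimately have "\<mu> * (\<mu> + 1) = (\<mu> - of_nat k) * (\<mu> - of_nat k - 1)"
    using k(1) by (metis vector_mul_rcancel)
  then have z: "(of_nat k + 1) * (2 * \<mu> - of_nat k) = 0" by (simp add: algebra_simps)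
  have "(of_nat k + 1 :: complex) \<noteq> 0" by (metis Suc_eq_plus1 of_nat_Suc of_nat_neq_0 add.commute)
  then have "2 * \<mu> - of_nat k = 0" using z by (metis mult_eq_0_iff)
  then have "\<mu> = of_nat k / 2" by (simp add: eq_divide_eq mult.commute)
  moreover have "N *v w = 0" if "k = 0" using k that by simp
  ultimately show ?thesis using that by blast
qed

text \<open>
  Raising an eigenvector ends at a highest weight \<open>\<mu> + p\<close>, which is half an integer.
\<close>

lemma eigenvalue_real:
  assumes v: "v \<noteq> 0" "H *v v = \<mu> *s v"
  shows "\<mu> \<in> \<real>"
proof -
  have "H *v (P *v x) = P *v (H *v x) + 1 *s (P *v x)" for x
    by (simp add: HP vec_eq_iff)
  from chain_ends[OF v this] obtain p where
    p: "((*v) P ^^ p) v \<noteq> 0" "P *v ((*v) P ^^ p) v = 0"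
       "H *v ((*v) P ^^ p) v = (\<mu> + of_nat p * 1) *s ((*v) P ^^ p) v"
    by auto
  obtain k :: nat where "\<mu> + of_nat p * 1 = of_nat k / 2"
    using highest_weight[OF p(1,3,2)] by blast
  then have "\<mu> = of_real (real k / 2 - real p)" by (simp add: algebra_simps)
  then show ?thesis by simp
qed

text \<open>
  A highest weight vector in the kernel of \<open>cas\<close> has weight \<open>k/2\<close> with \<open>k/2 (k/2 + 1) = 0\<close>, so its
  weight is \<open>0\<close> and it is a lowest weight vector too.
\<close>

lemma weightless_vector_in_casimir_kernel:
  assumes v: "v \<in> T" "v \<noteq> 0" and T0: "\<And>x. x \<in> T \<Longrightarrow> cas x = 0"
    and T: "\<And>x z. x \<in> T \<Longrightarrow> H *v x - z *s x \<in> T" "\<And>x. x \<in> T \<Longrightarrow> P *v x \<in> T"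
  obtains w where "w \<in> T" "w \<noteq> 0" "H *v w = 0" "P *v w = 0" "N *v w = 0"
proof -
  obtain v' \<mu> where v': "v' \<in> T" "v' \<noteq> 0" "H *v v' = \<mu> *s v'"
    using eigenvector_in_invariant_set[of v T H] v T by blast
  have "H *v (P *v x) = P *v (H *v x) + 1 *s (P *v x)" for x
    by (simp add: HP vec_eq_iff)
  from chain_ends[OF v'(2,3) this] obtain p where
    p: "((*v) P ^^ p) v' \<noteq> 0" "P *v ((*v) P ^^ p) v' = 0"
       "H *v ((*v) P ^^ p) v' = (\<mu> + of_nat p * 1) *s ((*v) P ^^ p) v'"
    by auto
  define w where "w = ((*v) P ^^ p) v'"
  have wT: "w \<in> T" unfolding w_def using v' T by (induction p) auto
  obtain k :: nat where k: "\<mu> + of_nat p * 1 = of_nat k / 2" "k = 0 \<Longrightarrow> N *v w = 0"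
    using highest_weight[OF p(1,3,2)] unfolding w_def by blast
  have Hw: "H *v w = (of_nat k / 2) *s w" and Pw: "P *v w = 0" and w0: "w \<noteq> 0"
    using p(1,2) p(3)[unfolded k(1)] unfolding w_def by auto
  have "0 = cas w" using T0 wT by simp
  also have "\<dots> = (of_nat k / 2 * (of_nat k / 2 + 1)) *s w"
    by (simp add: cas_def Hw Pw vector_scalar_commute vec_eq_iff algebra_simps)
  finally have "of_nat k * (of_nat k + 2) = (0 :: complex)" using w0 by (auto simp: field_simps)
  moreover have "(of_nat k + 2 :: complex) \<noteq> 0" by (metis of_nat_add of_nat_numeral of_nat_eq_0_iff add_is_0 zero_neq_numeral)
  ultimately have "k = 0" by simp
  then show ?thesis using that wT w0 Hw Pw k by simp
qed

end


definition cmat :: "real^'n^'n \<Rightarrow> complex^'n^'n" where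
  "cmat A = (\<chi> i j. complex_of_real (A $ i $ j))"

lemma cmat_mult: "cmat (A ** B) = cmat A ** cmat B"
  by (simp add: cmat_def matrix_matrix_mult_def vec_eq_iff)

lemma cmat_diff: "cmat (A - B) = cmat A - cmat B"
  by (simp add: cmat_def vec_eq_iff)

lemma cmat_add: "cmat (A + B) = cmat A + cmat B"
  by (simp add: cmat_def vec_eq_iff)

lemma cmat_Re_Im:
  "(\<chi> i. Re ((cmat A *v x) $ i)) = A *v (\<chi> i. Re (x $ i))"
  "(\<chi> i. Im ((cmat A *v x) $ i)) = A *v (\<chi> i. Im (x $ i))"
  by (simp_all add: cmat_def matrix_vector_mult_def vec_eq_iff)

definition cscale :: "complex \<Rightarrow> complex^'n^'n \<Rightarrow> complex^'n^'n" where
  "cscale c A = (\<chi> i j. c * A $ i $ j)"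

lemma cscale_mult_vec: "cscale c A *v x = c *s (A *v x)"
  by (simp add: cscale_def matrix_vector_mult_def vec_eq_iff sum_distrib_left mult.assoc)

locale su2_rep =
  fixes A1 A2 A3 :: "real^'n^'n"
  assumes A12: "A1 ** A2 - A2 ** A1 = A3" and A23: "A2 ** A3 - A3 ** A2 = A1"
    and A31: "A3 ** A1 - A1 ** A3 = A2"
begin

definition casimir :: "real^'n^'n" where
  "casimir = A1 ** A1 + A2 ** A2 + A3 ** A3"

lemma commute_vec:
  "A1 *v (A2 *v x) = A2 *v (A1 *v x) + A3 *v x"
  "A2 *v (A3 *v x) = A3 *v (A2 *v x) + A1 *v x"
  "A3 *v (A1 *v x) = A1 *v (A3 *v x) + A2 *v x"
  using arg_cong[OF A12, of "\<lambda>M. M *v x"] arg_cong[OF A23, of "\<lambda>M. M *v x"] arg_cong[OF A31, of "\<lambda>M. M *v x"]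
  by (auto simp: matrix_vector_mul_assoc matrix_vector_mult_diff_rdistrib algebra_simps)

lemma commute_cvec:
  "cmat A1 *v (cmat A2 *v x) = cmat A2 *v (cmat A1 *v x) + cmat A3 *v x"
  "cmat A2 *v (cmat A3 *v x) = cmat A3 *v (cmat A2 *v x) + cmat A1 *v x"
  "cmat A3 *v (cmat A1 *v x) = cmat A1 *v (cmat A3 *v x) + cmat A2 *v x"
  using arg_cong[OF A12, of "\<lambda>M. cmat M *v x"] arg_cong[OF A23, of "\<lambda>M. cmat M *v x"] arg_cong[OF A31, of "\<lambda>M. cmat M *v x"]
  by (auto simp: cmat_diff cmat_mult matrix_vector_mul_assoc matrix_vector_mult_diff_rdistrib algebra_simps)

lemma transpose_rep: "su2_rep (- transpose A1) (- transpose A2) (- transpose A3)"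
proof -
  have m: "(- transpose X) ** (- transpose Y) = transpose (Y ** X)" for X Y :: "real^'n^'n"
    by (simp add: matrix_transpose_mul) (simp add: matrix_matrix_mult_def vec_eq_iff)
  have d: "transpose X - transpose Y = - transpose (Y - X)" for X Y :: "real^'n^'n"
    by (simp add: transpose_def vec_eq_iff)
  show ?thesis by standard (simp_all only: m d A12 A23 A31)
qed

text \<open>
  With \<open>J\<^sub>k = \<i> A\<^sub>k\<close> the commutation relations become \<open>[J\<^sub>1, J\<^sub>2] = \<i> J\<^sub>3\<close> and cyclically; the ladder
  operators are \<open>J\<^sub>1 + \<i> J\<^sub>2 = \<i> A\<^sub>1 - A\<^sub>2\<close> and \<open>J\<^sub>1 - \<i> J\<^sub>2 = \<i> A\<^sub>1 + A\<^sub>2\<close>.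
\<close>

lemma ladder: "ladder (cscale \<i> (cmat A3)) (cscale \<i> (cmat A1) - cmat A2) (cscale \<i> (cmat A1) + cmat A2)"
proof -
  note r = commute_cvec
  show ?thesis
    by standard (simp_all add: cscale_mult_vec matrix_vector_mult_diff_rdistrib matrix_vector_mult_add_rdistrib
       matrix_vector_mult_diff_distrib matrix_vector_right_distrib vector_scalar_commute r,
       simp_all add: vec_eq_iff algebra_simps)
qed

interpretation L: ladder "cscale \<i> (cmat A3)" "cscale \<i> (cmat A1) - cmat A2" "cscale \<i> (cmat A1) + cmat A2"
  by (rule ladder)

text \<open>
  The real spectrum of \<open>\<i> A\<^sub>3\<close> makes the trace of \<open>(\<i> A\<^sub>3)\<^sup>2 = - A\<^sub>3\<^sup>2\<close> nonnegative. For
  \<open>sl(2, \<real>)\<close>, the split form of the same complex Lie algebra, the corresponding claim fails.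
\<close>

lemma trace_square_nonpos:
  shows "trace (A3 ** A3) \<le> 0"
proof -
  have "0 \<le> Re (trace (cscale \<i> (cmat A3) ** cscale \<i> (cmat A3)))"
    by (rule trace_square_nonneg) (rule L.eigenvalue_real)
  also have "\<dots> = - trace (A3 ** A3)"
    by (simp add: trace_def matrix_matrix_mult_def cscale_def cmat_def mult.assoc sum_negf)
  finally show ?thesis by simp
qed

lemma cas_casimir: "L.cas x = - (cmat casimir *v x)"
proof -
  have "cmat casimir *v x = cmat A1 *v (cmat A1 *v x) + cmat A2 *v (cmat A2 *v x) + cmat A3 *v (cmat A3 *v x)"
    by (simp add: casimir_def cmat_mult cmat_add matrix_vector_mul_assoc matrix_vector_mult_add_rdistrib)
  then show ?thesis
    by (simp add: L.cas_def commute_cvec cscale_mult_vec matrix_vector_mult_diff_rdistrib matrix_vector_mult_add_rdistrib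
       matrix_vector_mult_diff_distrib matrix_vector_right_distrib vector_scalar_commute)
qed

text \<open>
  The invariant vector is found in the complexification of \<open>S \<inter> ker casimir\<close>; its real part or its
  imaginary part is nonzero, and both are invariant. The subspace \<open>S\<close> allows the application to
  subrepresentations.
\<close>

lemma invariant_vector_in_casimir_kernel:
  assumes S: "subspace S" "\<And>x. x \<in> S \<Longrightarrow> A1 *v x \<in> S \<and> A2 *v x \<in> S \<and> A3 *v x \<in> S"
    and v: "v \<in> S" "v \<noteq> 0" "casimir *v v = 0"
  obtains w where "w \<in> S" "w \<noteq> 0" "A1 *v w = 0" "A2 *v w = 0" "A3 *v w = 0"
proof -
  define re im :: "complex^'n \<Rightarrow> real^'n" where "re x = (\<chi> i. Re (x $ i))" and "im x = (\<chi> i. Im (x $ i))" for x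
  have ri [simp]: "re (cmat A *v x) = A *v re x" "im (cmat A *v x) = A *v im x" for A x
    by (simp_all add: re_def im_def cmat_Re_Im)
  have sc [simp]: "re (z *s x) = Re z *\<^sub>R re x - Im z *\<^sub>R im x" "im (z *s x) = Re z *\<^sub>R im x + Im z *\<^sub>R re x" for z x
    by (simp_all add: re_def im_def vec_eq_iff)
  have ad [simp]: "re (x + y) = re x + re y" "re (x - y) = re x - re y"
      "im (x + y) = im x + im y" "im (x - y) = im x - im y" for x y
    by (simp_all add: re_def im_def vec_eq_iff)
  define T where "T = {x. re x \<in> S \<and> im x \<in> S \<and> cmat casimir *v x = 0}"
  have c0: "cmat casimir *v x = 0 \<longleftrightarrow> casimir *v re x = 0 \<and> casimir *v im x = 0" for x
  proof -
    have "y = 0 \<longleftrightarrow> re y = 0 \<and> im y = 0" for y by (auto simp: vec_eq_iff re_def im_def complex_eq_iff)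
    then show ?thesis by simp
  qed
  have comm: "casimir *v (A *v x) = A *v (casimir *v x)" if "A \<in> {A1,A2,A3}" for A x
  proof -
    have r: "A1 *v (A2 *v x) = A2 *v (A1 *v x) + A3 *v x"
       "A2 *v (A3 *v x) = A3 *v (A2 *v x) + A1 *v x"
       "A1 *v (A3 *v x) = A3 *v (A1 *v x) - A2 *v x" for x
      by (simp_all add: commute_vec)
    show ?thesis
      using that by (auto simp: casimir_def matrix_vector_mult_add_rdistrib r matrix_vector_right_distrib
        matrix_vector_mult_diff_distrib simp flip: matrix_vector_mul_assoc)
  qed
  have lin: "casimir *v (x + y) = casimir *v x + casimir *v y"
    "casimir *v (x - y) = casimir *v x - casimir *v y"
    "casimir *v (r *\<^sub>R x) = r *\<^sub>R (casimir *v x)" for x y r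
    by (simp_all add: matrix_vector_right_distrib matrix_vector_mult_diff_distrib matrix_vector_mult_scaleR)
  define cv where "cv = (\<chi> i. complex_of_real (v $ i))"
  have [simp]: "re cv = v" "im cv = 0" by (simp_all add: re_def im_def cv_def vec_eq_iff)
  have cv: "cv \<in> T" "cv \<noteq> 0"
  proof -
    show "cv \<in> T" using v S(1) by (simp add: T_def c0 subspace_0)
    have "re 0 = 0" by (simp add: re_def vec_eq_iff)
    then show "cv \<noteq> 0" using v(2) \<open>re cv = v\<close> by metis
  qed
  have T_diff: "x - y \<in> T" if "x \<in> T" "y \<in> T" for x y
    using that S(1) by (simp add: T_def c0 lin subspace_diff)
  have T_scale: "z *s x \<in> T" if "x \<in> T" for x z
    using that S(1) by (simp add: T_def c0 lin subspace_diff subspace_add subspace_scale)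
  have T_A: "cmat A *v x \<in> T" if "x \<in> T" "A \<in> {A1,A2,A3}" for x A
    using that S(2) by (auto simp: T_def c0 comm)
  obtain w where w: "w \<in> T" "w \<noteq> 0" "cscale \<i> (cmat A3) *v w = 0"
      "(cscale \<i> (cmat A1) - cmat A2) *v w = 0" "(cscale \<i> (cmat A1) + cmat A2) *v w = 0"
  proof (rule L.weightless_vector_in_casimir_kernel[OF cv])
    show "L.cas x = 0" if "x \<in> T" for x using that by (simp add: cas_casimir T_def)
    show "cscale \<i> (cmat A3) *v x - z *s x \<in> T" if "x \<in> T" for x z
      using that by (simp add: cscale_mult_vec T_diff T_scale T_A)
    show "(cscale \<i> (cmat A1) - cmat A2) *v x \<in> T" if "x \<in> T" for x
      using that by (simp add: cscale_mult_vec matrix_vector_mult_diff_rdistrib T_diff T_scale T_A)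
  qed blast
  have 3: "cmat A3 *v w = 0" using w(3) by (simp add: cscale_mult_vec)
  have "2 *s (cmat A2 *v w) = ((cscale \<i> (cmat A1) + cmat A2) *v w) - ((cscale \<i> (cmat A1) - cmat A2) *v w)"
    by (simp add: matrix_vector_mult_diff_rdistrib matrix_vector_mult_add_rdistrib vec_eq_iff)
  then have 2: "cmat A2 *v w = 0" by (simp add: w)
  have 1: "cmat A1 *v w = 0" using w(5) by (simp add: matrix_vector_mult_add_rdistrib 2 cscale_mult_vec)
  have z: "re 0 = 0" "im 0 = 0" by (simp_all add: re_def im_def vec_eq_iff)
  have re0: "A1 *v re w = 0 \<and> A2 *v re w = 0 \<and> A3 *v re w = 0"
    using 1 2 3 ri(1) z by metis
  have im0: "A1 *v im w = 0 \<and> A2 *v im w = 0 \<and> A3 *v im w = 0"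
    using 1 2 3 ri(2) z by metis
  have "re w \<noteq> 0 \<or> im w \<noteq> 0" using w(2) by (auto simp: vec_eq_iff re_def im_def complex_eq_iff)
  then show ?thesis using re0 im0 w(1) that unfolding T_def by blast
qed

end

section \<open>Hessian structures on the Lie algebra\<close>

text \<open>
  The Lie algebra \<open>su(2) \<oplus> \<real>\<close>: the cross product on the first three coordinates, with the fourth
  one central.
\<close>

definition bracket :: "real^4 \<Rightarrow> real^4 \<Rightarrow> real^4" where
  "bracket x y = vector [x$2 * y$3 - x$3 * y$2, x$3 * y$1 - x$1 * y$3, x$1 * y$2 - x$2 * y$1, 0]"

lemma bracket_nth [simp]:
  "bracket x y $ 1 = x$2 * y$3 - x$3 * y$2" "bracket x y $ 2 = x$3 * y$1 - x$1 * y$3"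
  "bracket x y $ 3 = x$1 * y$2 - x$2 * y$1" "bracket x y $ 4 = 0"
  by (simp_all add: bracket_def vector_def)

abbreviation ev :: "4 \<Rightarrow> real^4" where "ev i \<equiv> axis i 1"

lemma vec4_eq_iff: "(x::real^4) = y \<longleftrightarrow> x$1 = y$1 \<and> x$2 = y$2 \<and> x$3 = y$3 \<and> x$4 = y$4"
  by (simp add: vec_eq_iff forall_4)

lemma bracket_ev:
  "bracket (ev 1) (ev 2) = ev 3" "bracket (ev 2) (ev 3) = ev 1" "bracket (ev 3) (ev 1) = ev 2"
  "bracket (ev 2) (ev 1) = - ev 3" "bracket (ev 3) (ev 2) = - ev 1" "bracket (ev 1) (ev 3) = - ev 2"
  "bracket (ev 1) (ev 1) = 0" "bracket (ev 2) (ev 2) = 0" "bracket (ev 3) (ev 3) = 0" "bracket (ev 4) x = 0" "bracket x (ev 4) = 0"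
  by (simp_all add: vec4_eq_iff axis_def)

lemma ev_expansion: "x = x$1 *\<^sub>R ev 1 + x$2 *\<^sub>R ev 2 + x$3 *\<^sub>R ev 3 + x$4 *\<^sub>R ev 4"
  by (simp add: vec4_eq_iff axis_def)

lemma linear_eq_ev:
  assumes "linear f" "linear g" "\<And>i. i \<in> {1,2,3,4} \<Longrightarrow> f (ev i) = g (ev i)"
  shows "f x = (g x :: 'a::real_vector)"
proof -
  have *: "k x = x$1 *\<^sub>R k (ev 1) + x$2 *\<^sub>R k (ev 2) + x$3 *\<^sub>R k (ev 3) + x$4 *\<^sub>R k (ev 4)"
    if "linear k" for k :: "real^4 \<Rightarrow> 'a"
    by (subst ev_expansion[of x]) (simp only: linear_add[OF that] linear_scale[OF that])
  show ?thesis
    unfolding *[OF assms(1)] *[OF assms(2)] by (simp add: assms(3))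
qed

text \<open>
  The infinitesimal form of a left invariant Hessian structure, with \<open>dot x y = \<nabla>\<^sub>x y\<close>.
\<close>

locale hessian_algebra =
  fixes dot :: "real^4 \<Rightarrow> real^4 \<Rightarrow> real^4" and h :: "real^4 \<Rightarrow> real^4 \<Rightarrow> real"
  assumes bil: "bilinear dot" and hbil: "bilinear h"
    and hsym: "h x y = h y x" and hpos: "x \<noteq> 0 \<Longrightarrow> h x x > 0"
    and torsion: "dot x y - dot y x = bracket x y"
    and flat: "dot x (dot y z) - dot y (dot x z) = dot (bracket x y) z"
    and codazzi: "h (bracket x y) z = h x (dot y z) - h y (dot x z)"
begin

lemma lin: "linear (dot x)" "linear (\<lambda>x. dot x y)" "linear (h x)" "linear (\<lambda>x. h x y)"
  using bil hbil by (auto simp: bilinear_def)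

lemmas dot_simps = bilinear_ladd[OF bil] bilinear_radd[OF bil] bilinear_lsub[OF bil] bilinear_rsub[OF bil]
  bilinear_lneg[OF bil] bilinear_rneg[OF bil] bilinear_lzero[OF bil] bilinear_rzero[OF bil]
  bilinear_lmul[OF bil] bilinear_rmul[OF bil]
lemmas h_simps = bilinear_ladd[OF hbil] bilinear_radd[OF hbil] bilinear_lsub[OF hbil] bilinear_rsub[OF hbil]
  bilinear_lneg[OF hbil] bilinear_rneg[OF hbil] bilinear_lzero[OF hbil] bilinear_rzero[OF hbil]
  bilinear_lmul[OF hbil] bilinear_rmul[OF hbil]

definition left_mult :: "real^4 \<Rightarrow> real^4^4" where "left_mult x = matrix (dot x)"

lemma left_mult_vec [simp]: "left_mult x *v y = dot x y"
  by (simp add: left_mult_def matrix_works lin)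

lemma swap: "dot x (dot y z) = dot y (dot x z) + dot (bracket x y) z"
  using flat[of x y z] by (simp add: algebra_simps)

lemma central: "dot (ev 4) x = dot x (ev 4)" "dot (ev 4) (dot x y) = dot x (dot (ev 4) y)"
  using torsion[of "ev 4" x] swap[of "ev 4" x y] by (simp_all add: bracket_ev dot_simps)

lemma left_mult_commutator: "left_mult x ** left_mult y - left_mult y ** left_mult x = left_mult (bracket x y)"
  unfolding matrix_eq by (simp add: matrix_vector_mult_diff_rdistrib flat flip: matrix_vector_mul_assoc)

sublocale su2_rep "left_mult (ev 1)" "left_mult (ev 2)" "left_mult (ev 3)"
  by standard (simp_all add: left_mult_commutator bracket_ev)

lemma casimir_vec: "casimir *v x = dot (ev 1) (dot (ev 1) x) + dot (ev 2) (dot (ev 2) x) + dot (ev 3) (dot (ev 3) x)"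
  by (simp add: casimir_def matrix_vector_mult_add_rdistrib flip: matrix_vector_mul_assoc)

text \<open>
  The identity map of \<open>su(2)\<close> is a \<open>1\<close>-cocycle for the representation by left multiplications. The
  usual proof of Whitehead's lemma writes a cocycle \<open>f\<close> as a coboundary \<open>x \<mapsto> x \<cdot> u\<close> by solving
  \<open>C u = \<Sum> e\<^sub>i \<cdot> f(e\<^sub>i)\<close>; the right hand side for the identity is \<open>q\<close>.
\<close>

definition q :: "real^4" where
  "q = dot (ev 1) (ev 1) + dot (ev 2) (ev 2) + dot (ev 3) (ev 3)"

text \<open>
  Exchanging the factors in \<open>e\<^sub>j \<cdot> (e\<^sub>i \<cdot> e\<^sub>i)\<close> produces bracket terms, which cancel in the sum over \<open>i\<close>
  because the structure constants are antisymmetric.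
\<close>

lemma dot_q:
  assumes "i \<in> {1,2,3}"
  shows "dot (ev i) q = casimir *v ev i"
proof -
  have t: "dot (ev 1) (ev 2) = dot (ev 2) (ev 1) + ev 3" "dot (ev 2) (ev 3) = dot (ev 3) (ev 2) + ev 1"
     "dot (ev 3) (ev 1) = dot (ev 1) (ev 3) + ev 2"
    using torsion[of "ev 1" "ev 2"] torsion[of "ev 2" "ev 3"] torsion[of "ev 3" "ev 1"] by (simp_all add: bracket_ev algebra_simps)
  from assms consider "i = 1" | "i = 2" | "i = 3" by auto
  then show ?thesis
  proof cases
    case 1
    show ?thesis unfolding 1 q_def casimir_vec
      using swap[of "ev 1" "ev 2" "ev 2"] swap[of "ev 1" "ev 3" "ev 3"] t
      by (simp add: bracket_ev dot_simps algebra_simps)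
  next
    case 2
    show ?thesis unfolding 2 q_def casimir_vec
      using swap[of "ev 2" "ev 1" "ev 1"] swap[of "ev 2" "ev 3" "ev 3"] t
      by (simp add: bracket_ev dot_simps algebra_simps)
  next
    case 3
    show ?thesis unfolding 3 q_def casimir_vec
      using swap[of "ev 3" "ev 2" "ev 2"] swap[of "ev 3" "ev 1" "ev 1"] t
      by (simp add: bracket_ev dot_simps algebra_simps)
  qed
qed

text \<open>
  The Casimir operator commutes with \<open>su(2)\<close> as always, and with \<open>ev 4\<close> because that is central.
\<close>

lemma casimir_dot: "casimir *v dot x y = dot x (casimir *v y)"
proof (rule linear_eq_ev[of "\<lambda>x. casimir *v dot x y" "\<lambda>x. dot x (casimir *v y)"])
  show "linear (\<lambda>x. casimir *v dot x y)"
    using linear_compose[OF lin(2)[of y] matrix_vector_mul_linear[of casimir]] by (simp add: o_def)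
  show "linear (\<lambda>x. dot x (casimir *v y))" by (rule lin)
  fix i :: 4 assume "i \<in> {1,2,3,4}"
  then consider "i = 1" | "i = 2" | "i = 3" | "i = 4" by auto
  then show "casimir *v dot (ev i) y = dot (ev i) (casimir *v y)"
  proof cases
    case 1
    show ?thesis unfolding 1 casimir_vec
      by (simp add: dot_simps swap[of "ev 1" "ev 2"] swap[of "ev 1" "ev 3"] bracket_ev)
  next
    case 2
    show ?thesis unfolding 2 casimir_vec
      by (simp add: dot_simps swap[of "ev 2" "ev 1"] swap[of "ev 2" "ev 3"] bracket_ev)
  next
    case 3
    show ?thesis unfolding 3 casimir_vec
      by (simp add: dot_simps swap[of "ev 3" "ev 2"] swap[of "ev 3" "ev 1"] bracket_ev)
  next
    case 4
    show ?thesis unfolding 4 casimir_vec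
      by (simp add: dot_simps central(2))
  qed
qed

text \<open>
  Every element of \<open>su(2)\<close> is a sum of commutators.
\<close>

lemma trace_left_mult:
  assumes "x $ 4 = 0" shows "trace (left_mult x) = 0"
proof -
  have add: "trace (left_mult (x + y)) = trace (left_mult x) + trace (left_mult y)" "trace (left_mult (r *\<^sub>R x)) = r * trace (left_mult x)" for x y r
    by (simp_all add: trace_def left_mult_def matrix_def dot_simps sum.distrib sum_distrib_left)
  have z: "trace (left_mult (bracket x y)) = 0" for x y
    by (simp add: trace_sub trace_mul_sym[of "left_mult x" "left_mult y"] flip: left_mult_commutator)
  have "trace (left_mult (ev 1)) = 0" "trace (left_mult (ev 2)) = 0" "trace (left_mult (ev 3)) = 0"
    using z[of "ev 2" "ev 3"] z[of "ev 3" "ev 1"] z[of "ev 1" "ev 2"] by (simp_all add: bracket_ev)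
  then show ?thesis
    by (subst ev_expansion[of x]) (simp add: add assms)
qed

definition right_mult :: "real^4 \<Rightarrow> real^4^4" where "right_mult y = matrix (\<lambda>x. dot x y)"

lemma right_mult_vec [simp]: "right_mult y *v x = dot x y"
  by (simp add: right_mult_def matrix_works lin)

text \<open>
  Left and right multiplication by \<open>x\<close> differ by \<open>ad x\<close>, which has trace \<open>0\<close>. So the trace form of
  right multiplication vanishes on \<open>su(2)\<close> as well and is determined by its value at \<open>ev 4\<close>.
\<close>

lemma trace_right_mult:
  shows "trace (right_mult x) = x $ 4 * trace (right_mult (ev 4))"
proof -
  have add: "trace (right_mult (x + y)) = trace (right_mult x) + trace (right_mult y)" "trace (right_mult (r *\<^sub>R x)) = r * trace (right_mult x)" for x y r
    by (simp_all add: trace_def right_mult_def matrix_def dot_simps sum.distrib sum_distrib_left)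
  have "trace (left_mult x) - trace (right_mult x) = trace (matrix (bracket x))" for x
    by (simp add: trace_def left_mult_def right_mult_def matrix_def sum_subtractf flip: torsion)
  moreover have "trace (matrix (bracket x)) = 0" for x
    by (simp add: trace_def matrix_def sum_4 axis_def)
  ultimately have "trace (right_mult (ev 1)) = 0" "trace (right_mult (ev 2)) = 0" "trace (right_mult (ev 3)) = 0"
    using trace_left_mult by (auto simp: axis_def)
  then show ?thesis
    by (subst ev_expansion[of x]) (simp add: add)
qed

text \<open>
  The generators can be permuted cyclically, so each of the three squares has trace at most \<open>0\<close>.
\<close>

lemma trace_casimir: "trace casimir \<le> 0"
proof -
  interpret r1: su2_rep "left_mult (ev 2)" "left_mult (ev 3)" "left_mult (ev 1)" by standard (rule A23 A31 A12)+
  interpret r2: su2_rep "left_mult (ev 3)" "left_mult (ev 1)" "left_mult (ev 2)" by standard (rule A23 A31 A12)+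
  show ?thesis unfolding casimir_def trace_add
    using r1.trace_square_nonpos r2.trace_square_nonpos trace_square_nonpos by linarith
qed

text \<open>
  By the Codazzi equation, a vector killed by \<open>su(2)\<close> is orthogonal to \<open>[su(2), su(2)] = su(2)\<close>.
\<close>

lemma invariant_vector_zero:
  assumes "w $ 4 = 0" "dot (ev 1) w = 0" "dot (ev 2) w = 0" "dot (ev 3) w = 0"
  shows "w = 0"
proof (rule ccontr)
  assume "w \<noteq> 0"
  have "h (ev 3) w = 0" "h (ev 1) w = 0" "h (ev 2) w = 0"
    using codazzi[of "ev 1" "ev 2" w] codazzi[of "ev 2" "ev 3" w] codazzi[of "ev 3" "ev 1" w] assms
    by (simp_all add: bracket_ev h_simps)
  then have "h w w = 0"
    by (subst ev_expansion[of w]) (simp add: h_simps assms(1))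
  then show False using hpos[OF \<open>w \<noteq> 0\<close>] by simp
qed

text \<open>
  An invariant vector \<open>n\<close> of the dual representation is orthogonal to \<open>x \<cdot> y - y \<cdot> x = [x, y]\<close>, so it
  spans the complement of \<open>su(2)\<close> and \<open>su(2) \<cdot> z \<subseteq> su(2)\<close> for all \<open>z\<close>. The Casimir operator thus
  restricts to \<open>S = su(2)\<close>, injectively because \<open>S\<close> contains no invariant vectors. Whitehead's
  argument then gives \<open>u \<in> S\<close> with \<open>x \<cdot> u = x\<close> on \<open>S\<close>, against \<open>trace_left_mult\<close>.
\<close>

lemma casimir_regular: "casimir *v v = 0 \<Longrightarrow> v = 0"
proof (rule ccontr)
  assume v: "casimir *v v = 0" "v \<noteq> 0"
  interpret T: su2_rep "- transpose (left_mult (ev 1))" "- transpose (left_mult (ev 2))" "- transpose (left_mult (ev 3))"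
    by (rule transpose_rep)
  have "T.casimir = transpose casimir"
  proof -
    have "(- transpose X) ** (- transpose X) = transpose (X ** X)" for X :: "real^4^4"
      by (simp add: matrix_transpose_mul) (simp add: matrix_matrix_mult_def vec_eq_iff)
    then show ?thesis unfolding T.casimir_def casimir_def by (simp add: transpose_def vec_eq_iff)
  qed
  moreover have "\<not> invertible casimir" using v matrix_left_invertible_ker[of casimir] invertible_left_inverse by blast
  then have "\<not> invertible (transpose casimir)" by (simp add: invertible_det_nz)
  ultimately obtain v' where v': "v' \<noteq> 0" "T.casimir *v v' = 0"
    using matrix_left_invertible_ker[of "transpose casimir"] invertible_left_inverse[of "transpose casimir"] by auto
  obtain n where n: "n \<noteq> 0" "- transpose (left_mult (ev 1)) *v n = 0" "- transpose (left_mult (ev 2)) *v n = 0" "- transpose (left_mult (ev 3)) *v n = 0"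
    by (rule T.invariant_vector_in_casimir_kernel[of UNIV v']) (use v' in auto)
  have z: "n \<bullet> dot (ev i) x = 0" if i: "i \<in> {1,2,3}" for i x
  proof -
    have "transpose (left_mult (ev i)) *v n = 0"
    proof -
      have neg: "- A *v n = - (A *v n)" for A :: "real^4^4" by (simp add: matrix_vector_mult_def vec_eq_iff sum_negf)
      show ?thesis using n i by (auto simp: neg)
    qed
    then have "(transpose (left_mult (ev i)) *v n) \<bullet> x = 0" by simp
    then show ?thesis by (simp add: dot_lmul_matrix)
  qed
  have zb: "n \<bullet> bracket (ev i) (ev j) = 0" if "i \<in> {1,2,3}" "j \<in> {1,2,3}" for i j
    using z[of i "ev j"] z[of j "ev i"] that by (simp add: inner_diff_right flip: torsion)
  have n123: "n $ 1 = 0" "n $ 2 = 0" "n $ 3 = 0"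
    using zb[of 1 2] zb[of 2 3] zb[of 3 1] by (simp_all add: bracket_ev inner_axis)
  then have "n $ 4 \<noteq> 0" using n(1) by (auto simp: vec4_eq_iff)
  then have d4: "dot (ev i) x $ 4 = 0" if "i \<in> {1,2,3}" for i x
    using z[OF that, of x] n123 by (simp add: inner_vec_def sum_4)
  define S where "S = {x :: real^4. x $ 4 = 0}"
  have S: "subspace S" unfolding S_def by (rule subspaceI) auto
  have CS: "casimir *v x \<in> S" for x by (simp add: S_def casimir_vec d4)
  have inj: "x = 0" if x: "x \<in> S" "casimir *v x = 0" for x
  proof (rule ccontr)
    assume "x \<noteq> 0"
    obtain w where "w \<in> S" "w \<noteq> 0" "left_mult (ev 1) *v w = 0" "left_mult (ev 2) *v w = 0" "left_mult (ev 3) *v w = 0"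
      by (rule invariant_vector_in_casimir_kernel[of S x]) (use S x \<open>x \<noteq> 0\<close> d4 in \<open>auto simp: S_def\<close>)
    then show False using invariant_vector_zero[of w] by (simp add: S_def)
  qed
  have injS: "inj_on ((*v) casimir) S"
  proof (rule inj_onI)
    fix x y assume xy: "x \<in> S" "y \<in> S" "casimir *v x = casimir *v y"
    then have "casimir *v (x - y) = 0" by (simp add: matrix_vector_mult_diff_distrib)
    then show "x = y" using inj[of "x - y"] xy S subspace_diff by auto
  qed
  have "(*v) casimir ` S = S"
  proof (rule subspace_dim_equal)
    show "subspace ((*v) casimir ` S)" using S by (simp add: linear_subspace_image)
    show "dim S \<le> dim ((*v) casimir ` S)"
      using S injS by (simp add: dim_image_eq span_eq_iff[THEN iffD2])
  qed (use S CS in auto)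
  moreover have "q \<in> S" by (simp add: q_def S_def d4)
  ultimately have "q \<in> (*v) casimir ` S" by simp
  then obtain u where u: "u \<in> S" "casimir *v u = q" by (rule imageE) auto
  have eu: "dot (ev i) u = ev i" if i: "i \<in> {1,2,3}" for i
  proof -
    have "casimir *v (dot (ev i) u - ev i) = 0"
      using i by (simp add: matrix_vector_mult_diff_distrib casimir_dot u dot_q)
    moreover have "dot (ev i) u - ev i \<in> S" using i d4 by (auto simp: S_def axis_def)
    ultimately show ?thesis using inj by fastforce
  qed
  \<comment> \<open>The matrix of left multiplication by \<open>u\<close> has diagonal \<open>1, 1, 1, 0\<close>.\<close>
  have ue: "dot u (ev i) = ev i + bracket u (ev i)" if "i \<in> {1,2,3}" for i
    using torsion[of u "ev i"] eu[OF that] by (simp add: algebra_simps)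
  have u4: "u $ 4 = 0" using u by (simp add: S_def)
  have "dot u (ev 4) $ 4 = 0"
    by (subst ev_expansion[of u]) (simp add: dot_simps d4 u4)
  then have "trace (left_mult u) = 3"
    unfolding trace_def left_mult_def matrix_def sum_4 by (simp add: ue) (simp add: axis_def)
  then show False using trace_left_mult[OF u4] by simp
qed

text \<open>
  Here \<open>K\<close> is the inverse of the Casimir operator, and \<open>u\<close> and \<open>\<psi>\<close> come from Whitehead's argument
  applied to the left multiplications and to their transposes with respect to \<open>h\<close>: the Codazzi
  equation says that the identity is a cocycle for the dual representation, too.
\<close>

theorem no_hessian_algebra: False
proof -
  have "invertible casimir"
    using casimir_regular by (simp add: invertible_left_inverse matrix_left_invertible_ker)
  then obtain K where K: "casimir ** K = mat 1" "K ** casimir = mat 1" by (auto simp: invertible_def)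
  have CK [simp]: "casimir *v (K *v x) = x" and KC [simp]: "K *v (casimir *v x) = x" for x
    using K by (simp_all add: matrix_vector_mul_assoc)
  have Kdot: "K *v dot x y = dot x (K *v y)" for x y
    by (metis casimir_dot CK KC)
  define u where "u = K *v q"
  have Cu: "casimir *v u = q" by (simp add: u_def)
  have eu: "dot (ev i) u = ev i" if "i \<in> {1,2,3}" for i
    by (metis u_def Kdot dot_q[OF that] KC)
  \<comment> \<open>\<open>e\<^sub>4 \<cdot> u - e\<^sub>4\<close> is killed by \<open>su(2)\<close>, hence by the invertible Casimir operator.\<close>
  have e4u: "dot (ev 4) u = ev 4"
  proof -
    have "dot (ev i) (dot (ev 4) u - ev 4) = 0" if "i \<in> {1,2,3}" for i
      using central[of "ev i"] eu[OF that] by (simp add: dot_simps flip: central)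
    then have "casimir *v (dot (ev 4) u - ev 4) = 0" by (simp add: casimir_vec dot_simps)
    then show ?thesis using casimir_regular by fastforce
  qed
  have xu: "dot x u = x" for x
    by (rule linear_eq_ev[of "\<lambda>x. dot x u" "\<lambda>x. x"]) (use eu e4u lin in \<open>auto simp: linear_ident\<close>)
  have "right_mult q = casimir"
    unfolding matrix_eq by (simp add: xu casimir_dot flip: Cu)
      (metis casimir_dot xu)
  then have tq: "q $ 4 * trace (right_mult (ev 4)) \<le> 0" using trace_casimir trace_right_mult[of q] by simp
  have "right_mult u = mat 1" unfolding matrix_eq by (simp add: xu)
  then have tu: "u $ 4 * trace (right_mult (ev 4)) = 4" using trace_right_mult[of u] by (simp add: trace_I)
  define psi where "psi z = h (ev 1) (dot (ev 1) (K *v z)) + h (ev 2) (dot (ev 2) (K *v z)) + h (ev 3) (dot (ev 3) (K *v z))" for z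
  have psi_lin: "linear psi"
    unfolding psi_def by (rule linearI) (simp_all add: dot_simps h_simps matrix_vector_right_distrib matrix_vector_mult_scaleR algebra_simps)
  have cod: "h x (dot y z) = h y (dot x z) + h (bracket x y) z" for x y z using codazzi[of x y z] by simp
  \<comment> \<open>The Codazzi equation moves \<open>ev i\<close> out; the bracket terms cancel by invariance of the Casimir element.\<close>
  have psi1: "psi (dot (ev i) (casimir *v z)) = h (ev i) (casimir *v z)" if "i \<in> {1,2,3}" for i z
  proof -
    have "psi (dot (ev i) (casimir *v z)) = h (ev 1) (dot (ev 1) (dot (ev i) z)) + h (ev 2) (dot (ev 2) (dot (ev i) z)) + h (ev 3) (dot (ev 3) (dot (ev i) z))"
      by (simp add: psi_def flip: casimir_dot)
    also have "\<dots> = h (ev i) (casimir *v z)"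
    proof -
      from that consider "i = 1" | "i = 2" | "i = 3" by auto
      then show ?thesis
      proof cases
        case 1
        show ?thesis unfolding 1 casimir_vec
          using cod[of "ev 2" "ev 1" "dot (ev 2) z"] cod[of "ev 3" "ev 1" "dot (ev 3) z"]
          by (simp add: dot_simps h_simps swap[of "ev 2" "ev 1"] swap[of "ev 3" "ev 1"] bracket_ev)
      next
        case 2
        show ?thesis unfolding 2 casimir_vec
          using cod[of "ev 1" "ev 2" "dot (ev 1) z"] cod[of "ev 3" "ev 2" "dot (ev 3) z"]
          by (simp add: dot_simps h_simps swap[of "ev 1" "ev 2"] swap[of "ev 3" "ev 2"] bracket_ev)
      next
        case 3
        show ?thesis unfolding 3 casimir_vec
          using cod[of "ev 1" "ev 3" "dot (ev 1) z"] cod[of "ev 2" "ev 3" "dot (ev 2) z"]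
          by (simp add: dot_simps h_simps swap[of "ev 1" "ev 3"] swap[of "ev 2" "ev 3"] bracket_ev)
      qed
    qed
    finally show ?thesis .
  qed
  have psi_i: "psi (dot (ev i) z) = h (ev i) z" if "i \<in> {1,2,3}" for i z
    using psi1[OF that, of "K *v z"] by simp
  \<comment> \<open>Images of the Casimir operator are sums of products with \<open>ev i\<close>, \<open>i \<in> {1, 2, 3}\<close>.\<close>
  have "psi (dot (ev 4) (casimir *v z)) = h (ev 4) (casimir *v z)" for z
  proof -
    have "psi (dot (ev 4) (dot (ev i) y)) = h (ev 4) (dot (ev i) y)" if "i \<in> {1,2,3}" for i y
      using psi_i[OF that, of "dot (ev 4) y"] cod[of "ev 4" "ev i" y] by (simp add: central(2) bracket_ev h_simps)
    then show ?thesis by (simp add: casimir_vec dot_simps h_simps linear_add[OF psi_lin])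
  qed
  then have psi_4: "psi (dot (ev 4) z) = h (ev 4) z" for z by (metis CK)
  have psi: "psi (dot x z) = h x z" for x z
  proof (rule linear_eq_ev[of "\<lambda>x. psi (dot x z)" "\<lambda>x. h x z"])
    show "linear (\<lambda>x. psi (dot x z))" using linear_compose[OF lin(2)[of z] psi_lin] by (simp add: o_def)
  qed (use psi_i psi_4 lin in auto)
  have psi_br: "psi (bracket x y) = 0" for x y
    by (simp add: linear_diff[OF psi_lin] psi hsym[of x y] flip: torsion)
  have psi4: "psi z = z $ 4 * psi (ev 4)" for z
    using psi_br[of "ev 2" "ev 3"] psi_br[of "ev 3" "ev 1"] psi_br[of "ev 1" "ev 2"]
    by (subst ev_expansion[of z]) (simp add: linear_add[OF psi_lin] linear_scale[OF psi_lin] bracket_ev)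
  have "u \<noteq> 0" using xu[of "ev 1"] by (auto simp: dot_simps)
  then have pu: "u $ 4 * psi (ev 4) > 0" using psi[of u u] hpos[of u] psi4[of u] by (simp add: xu)
  have pos: "h (ev i) (ev i) > 0" for i by (rule hpos) simp
  have "psi q > 0" unfolding q_def using pos[of 1] pos[of 2] pos[of 3] by (simp add: linear_add[OF psi_lin] psi)
  then have pq: "q $ 4 * psi (ev 4) > 0" using psi4[of q] by simp
  \<comment> \<open>\<open>q $ 4\<close> and \<open>u $ 4\<close> have the same sign by \<open>psi\<close>, but not by the trace form.\<close>
  have "(u $ 4 * psi (ev 4)) * (q $ 4 * trace (right_mult (ev 4))) = (q $ 4 * psi (ev 4)) * (u $ 4 * trace (right_mult (ev 4)))" by simp
  then show False using pu pq tu tq by (smt (verit) mult_nonneg_nonpos mult_pos_pos)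
qed

end

section \<open>Second derivatives and linear vector fields\<close>

abbreviation dd :: "'a \<Rightarrow> ('a::euclidean_space \<Rightarrow> 'b::real_normed_vector) \<Rightarrow> 'a \<Rightarrow> 'b" where
  "dd v f x \<equiv> frechet_derivative f (at x) v"

lemma dd_cong:
  assumes "open U" "x \<in> U" "\<And>y. y \<in> U \<Longrightarrow> f y = g y"
  shows "f differentiable (at x) \<longleftrightarrow> g differentiable (at x)" "dd v f x = dd v g x"
proof -
  have "(f has_derivative D) (at x) \<longleftrightarrow> (g has_derivative D) (at x)" for D
    using has_derivative_transform_within_open[of f D x UNIV U g] has_derivative_transform_within_open[of g D x UNIV U f] assms
    by metis
  then show "f differentiable (at x) \<longleftrightarrow> g differentiable (at x)" "dd v f x = dd v g x"
    by (simp_all add: differentiable_def frechet_derivative_def)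
qed

lemma dd_eqI: "(f has_derivative D) (at x) \<Longrightarrow> dd v f x = D v"
  using frechet_derivative_at by metis

lemma Ck_on_cong:
  assumes "open U" "\<And>x. x \<in> U \<Longrightarrow> f x = g x"
  shows "Ck_on k U f \<longleftrightarrow> Ck_on k U g"
  using assms(2)
proof (induction k arbitrary: f g)
  case 0
  then show ?case by (simp cong: continuous_on_cong)
next
  case (Suc k)
  have "(\<forall>x\<in>U. f differentiable (at x)) \<longleftrightarrow> (\<forall>x\<in>U. g differentiable (at x))"
    by (intro ball_cong refl dd_cong(1)[OF assms(1)] Suc.prems)
  moreover have "Ck_on k U (dd v f) \<longleftrightarrow> Ck_on k U (dd v g)" for v
    by (rule Suc.IH) (rule dd_cong(2)[OF assms(1)], assumption, rule Suc.prems)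
  ultimately show ?case by simp
qed

lemma Ck_on_Suc_D: "Ck_on (Suc k) U f \<Longrightarrow> Ck_on k U f"
proof (induction k arbitrary: f)
  case 0
  then show ?case
    by (auto intro!: continuous_at_imp_continuous_on differentiable_imp_continuous_within)
qed auto

lemma Ck_on_add:
  assumes "open U" "Ck_on k U f" "Ck_on k U g"
  shows "Ck_on k U (\<lambda>x. f x + g x)"
  using assms(2,3)
proof (induction k arbitrary: f g)
  case 0
  then show ?case by (simp add: continuous_on_add)
next
  case (Suc k)
  have "dd v (\<lambda>x. f x + g x) x = dd v f x + dd v g x" if "x \<in> U" for x v
    using Suc.prems that by (intro dd_eqI) (auto intro!: has_derivative_add simp: frechet_derivative_works)
  then have "Ck_on k U (dd v (\<lambda>x. f x + g x)) \<longleftrightarrow> Ck_on k U (\<lambda>x. dd v f x + dd v g x)" for v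
    by (intro Ck_on_cong assms(1)) auto
  then show ?case using Suc by auto
qed

lemma Ck_on_const: "Ck_on k U (\<lambda>x. c)"
  by (induction k arbitrary: c) (auto simp: frechet_derivative_const)

lemma Ck_on_linear:
  assumes "bounded_linear f" shows "Ck_on k U f"
proof (cases k)
  case 0
  then show ?thesis using assms by (simp add: linear_continuous_on)
next
  case (Suc k')
  have "(f has_derivative f) (at x)" for x using assms by (rule bounded_linear_imp_has_derivative)
  then have "f differentiable (at x)" "dd v f = (\<lambda>_. f v)" for x v
    by (auto simp: differentiable_def dd_eqI)
  then show ?thesis by (simp add: Suc Ck_on_const)
qed

lemma Ck_on_linear_mult:
  fixes f l :: "'a::euclidean_space \<Rightarrow> real"
  assumes "open U" "bounded_linear l" "Ck_on k U f"
  shows "Ck_on k U (\<lambda>x. l x * f x)"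
  using assms(3)
proof (induction k arbitrary: f)
  case 0
  then show ?case using linear_continuous_on[OF assms(2), of U] by (simp add: continuous_on_mult)
next
  case (Suc k)
  have d: "((\<lambda>x. l x * f x) has_derivative (\<lambda>v. l x * dd v f x + l v * f x)) (at x)" if "x \<in> U" for x
    using Suc.prems that
    by (intro has_derivative_mult bounded_linear_imp_has_derivative[OF assms(2)]) (simp add: frechet_derivative_works)
  have "Ck_on k U (\<lambda>x. l x * dd v f x + l v * f x)" for v
  proof (intro Ck_on_add assms(1))
    show "Ck_on k U (\<lambda>x. l x * dd v f x)" using Suc by auto
    have "Ck_on k U f" using Suc.prems by (rule Ck_on_Suc_D)
    then show "Ck_on k U (\<lambda>x. l v * f x)"
    proof (induction k arbitrary: f)
      case 0
      then show ?case by (auto intro!: continuous_on_mult)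
    next
      case (Suc k)
      have d: "((\<lambda>x. l v * f x) has_derivative (\<lambda>w. l v * dd w f x)) (at x)" if "x \<in> U" for x
        using Suc.prems that by (intro has_derivative_mult_right) (simp add: frechet_derivative_works)
      then have "Ck_on k U (dd w (\<lambda>x. l v * f x)) \<longleftrightarrow> Ck_on k U (\<lambda>x. l v * dd w f x)" for w
        by (intro Ck_on_cong assms(1) dd_eqI)
      then show ?case using Suc d by (auto simp: differentiable_def)
    qed
  qed
  moreover have "Ck_on k U (dd v (\<lambda>x. l x * f x)) \<longleftrightarrow> Ck_on k U (\<lambda>x. l x * dd v f x + l v * f x)" for v
    using d by (intro Ck_on_cong assms(1) dd_eqI)
  ultimately show ?case using d by (auto simp: differentiable_def)
qed

lemma Ck_on_sum:
  assumes "open U" "finite I" "\<And>i. i \<in> I \<Longrightarrow> Ck_on k U (f i)"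
  shows "Ck_on k U (\<lambda>x. \<Sum>i\<in>I. f i x)"
  using assms(2,3) by (induction I rule: finite_induct) (auto simp: Ck_on_const Ck_on_add[OF assms(1)])

lemma dd_linear: "f differentiable (at x) \<Longrightarrow> linear (\<lambda>v. dd v f x)"
  using linear_frechet_derivative by blast

lemma dd_expand:
  fixes f :: "'a::euclidean_space \<Rightarrow> real"
  assumes "f differentiable (at x)"
  shows "dd v f x = (\<Sum>b\<in>Basis. (v \<bullet> b) * dd b f x)"
proof -
  have "dd v f x = dd (\<Sum>b\<in>Basis. (v \<bullet> b) *\<^sub>R b) f x" by (simp add: euclidean_representation)
  also have "\<dots> = (\<Sum>b\<in>Basis. (v \<bullet> b) * dd b f x)"
    using dd_linear[OF assms] by (simp add: linear_sum linear_scale)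
  finally show ?thesis .
qed

lemma Ck_on_vector_field:
  fixes f :: "'a::euclidean_space \<Rightarrow> real"
  assumes U: "open U" and T: "linear T" and f: "Ck_on (Suc k) U f"
  shows "Ck_on k U (\<lambda>x. dd (T x) f x)"
proof -
  have "Ck_on k U (\<lambda>x. \<Sum>b\<in>Basis. (T x \<bullet> b) * dd b f x)"
  proof (intro Ck_on_sum U finite_Basis Ck_on_linear_mult)
    show "bounded_linear (\<lambda>x. T x \<bullet> b)" for b
      using bounded_linear_compose[OF bounded_linear_inner_left linear_conv_bounded_linear[THEN iffD1, OF T]] .
    show "Ck_on k U (\<lambda>x. dd b f x)" for b using f by simp
  qed
  also have "?this \<longleftrightarrow> ?thesis"
    using f by (intro Ck_on_cong U dd_expand[symmetric]) simp
  finally show ?thesis .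
qed

text \<open>
  Two applications of the mean value theorem to the second order difference over a parallelogram.
\<close>

lemma mixed_difference:
  fixes f :: "'a::euclidean_space \<Rightarrow> real"
  assumes U: "ball x e \<subseteq> U" and f: "Ck_on 2 U f" and t: "0 < t" "t * (norm v + norm w) < e"
  obtains z where "dist z x \<le> t * (norm v + norm w)"
    "f (x + t *\<^sub>R v + t *\<^sub>R w) - f (x + t *\<^sub>R v) - f (x + t *\<^sub>R w) + f x = t\<^sup>2 * dd w (dd v f) z"
proof -
  have near: "dist (x + s *\<^sub>R v + r *\<^sub>R w) x \<le> t * (norm v + norm w)" if "0 \<le> s" "s \<le> t" "0 \<le> r" "r \<le> t" for s r
  proof -
    have "dist (x + s *\<^sub>R v + r *\<^sub>R w) x \<le> norm (s *\<^sub>R v) + norm (r *\<^sub>R w)"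
      using norm_triangle_ineq[of "s *\<^sub>R v" "r *\<^sub>R w"] by (simp add: dist_norm add.assoc)
    also have "\<dots> \<le> t * norm v + t * norm w" using that by (auto intro!: add_mono mult_right_mono)
    finally show ?thesis by (simp add: algebra_simps)
  qed
  have inU: "x + s *\<^sub>R v + r *\<^sub>R w \<in> U" if "0 \<le> s" "s \<le> t" "0 \<le> r" "r \<le> t" for s r
    using near[OF that] t U by (auto simp: dist_commute)
  have fd: "(f has_derivative frechet_derivative f (at y)) (at y)"
    and fvd: "(dd v f has_derivative frechet_derivative (dd v f) (at y)) (at y)" if "y \<in> U" for y
    using f that by (auto simp: numeral_2_eq_2 frechet_derivative_works)
  have l1: "dd (r *\<^sub>R u) f y = r * dd u f y" "dd (r *\<^sub>R u) (dd v f) y = r * dd u (dd v f) y" if "y \<in> U" for r u y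
    using linear_scale[OF has_derivative_linear[OF fd[OF that]]] linear_scale[OF has_derivative_linear[OF fvd[OF that]]] by auto
  have D1: "((\<lambda>s. f (x + s *\<^sub>R v + r *\<^sub>R w)) has_real_derivative dd v f (x + s *\<^sub>R v + r *\<^sub>R w)) (at s)"
    if "0 \<le> s" "s \<le> t" "0 \<le> r" "r \<le> t" for s r
  proof -
    have "((\<lambda>s. x + s *\<^sub>R v + r *\<^sub>R w) has_derivative (\<lambda>h. h *\<^sub>R v)) (at s)"
      by (auto intro!: derivative_eq_intros)
    from has_derivative_compose[OF this fd[OF inU[OF that]]]
    show ?thesis unfolding has_field_derivative_def using inU[OF that] by (simp add: l1 mult_commute_abs)
  qed
  have D2: "((\<lambda>r. dd v f (x + s *\<^sub>R v + r *\<^sub>R w)) has_real_derivative dd w (dd v f) (x + s *\<^sub>R v + r *\<^sub>R w)) (at r)"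
    if "0 \<le> s" "s \<le> t" "0 \<le> r" "r \<le> t" for s r
  proof -
    have "((\<lambda>r. x + s *\<^sub>R v + r *\<^sub>R w) has_derivative (\<lambda>h. h *\<^sub>R w)) (at r)"
      by (auto intro!: derivative_eq_intros)
    from has_derivative_compose[OF this fvd[OF inU[OF that]]]
    show ?thesis unfolding has_field_derivative_def using inU[OF that] by (simp add: l1 mult_commute_abs)
  qed
  define \<phi> where "\<phi> s = f (x + s *\<^sub>R v + t *\<^sub>R w) - f (x + s *\<^sub>R v + 0 *\<^sub>R w)" for s
  have "\<exists>s. 0 < s \<and> s < t \<and> \<phi> t - \<phi> 0 = (t - 0) * (dd v f (x + s *\<^sub>R v + t *\<^sub>R w) - dd v f (x + s *\<^sub>R v + 0 *\<^sub>R w))"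
    unfolding \<phi>_def using t(1) by (intro MVT2 DERIV_diff D1) auto
  then obtain s where s: "0 < s" "s < t"
    "\<phi> t - \<phi> 0 = t * (dd v f (x + s *\<^sub>R v + t *\<^sub>R w) - dd v f (x + s *\<^sub>R v + 0 *\<^sub>R w))" by auto
  have "\<exists>r. 0 < r \<and> r < t \<and> dd v f (x + s *\<^sub>R v + t *\<^sub>R w) - dd v f (x + s *\<^sub>R v + 0 *\<^sub>R w)
      = (t - 0) * dd w (dd v f) (x + s *\<^sub>R v + r *\<^sub>R w)"
    using t(1) s by (intro MVT2 D2) auto
  then obtain r where r: "0 < r" "r < t" "dd v f (x + s *\<^sub>R v + t *\<^sub>R w) - dd v f (x + s *\<^sub>R v + 0 *\<^sub>R w)
      = t * dd w (dd v f) (x + s *\<^sub>R v + r *\<^sub>R w)" by auto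
  show ?thesis
  proof (rule that)
    show "dist (x + s *\<^sub>R v + r *\<^sub>R w) x \<le> t * (norm v + norm w)" using s r by (intro near) auto
    show "f (x + t *\<^sub>R v + t *\<^sub>R w) - f (x + t *\<^sub>R v) - f (x + t *\<^sub>R w) + f x = t\<^sup>2 * dd w (dd v f) (x + s *\<^sub>R v + r *\<^sub>R w)"
      using s(3) unfolding r(3) by (simp add: \<phi>_def power2_eq_square algebra_simps)
  qed
qed

text \<open>
  The second order difference is symmetric in \<open>v\<close> and \<open>w\<close>, so \<open>mixed_difference\<close> yields points
  arbitrarily close to \<open>x\<close> at which the two mixed derivatives agree; continuity does the rest.
\<close>

lemma second_derivative_symmetric:
  fixes f :: "'a::euclidean_space \<Rightarrow> real"
  assumes U: "open U" "x \<in> U" and f: "Ck_on 2 U f"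
  shows "dd w (dd v f) x = dd v (dd w f) x"
proof (rule ccontr)
  assume ne: "dd w (dd v f) x \<noteq> dd v (dd w f) x"
  define \<delta> where "\<delta> = \<bar>dd w (dd v f) x - dd v (dd w f) x\<bar> / 2"
  have \<delta>: "\<delta> > 0" using ne by (simp add: \<delta>_def)
  have "continuous_on U (dd w (dd v f))" "continuous_on U (dd v (dd w f))"
    using f by (simp_all add: numeral_2_eq_2)
  then have c: "isCont (dd w (dd v f)) x" "isCont (dd v (dd w f)) x"
    using U by (simp_all add: continuous_on_eq_continuous_at)
  obtain e1 where e1: "e1 > 0" "\<And>y. dist y x < e1 \<Longrightarrow> dist (dd w (dd v f) y) (dd w (dd v f) x) < \<delta>"
    using c(1) \<delta> unfolding continuous_at_eps_delta dist_real_def dist_norm by blast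
  obtain e2 where e2: "e2 > 0" "\<And>y. dist y x < e2 \<Longrightarrow> dist (dd v (dd w f) y) (dd v (dd w f) x) < \<delta>"
    using c(2) \<delta> unfolding continuous_at_eps_delta dist_real_def dist_norm by blast
  obtain e3 where e3: "e3 > 0" "ball x e3 \<subseteq> U" using U openE by blast
  define e where "e = min e1 (min e2 e3)"
  have e: "e > 0" "ball x e \<subseteq> U" using e1 e2 e3 by (auto simp: e_def)
  define t where "t = e / (2 * (norm v + norm w + 1))"
  have pos: "norm v + norm w + 1 > 0" by (simp add: add_nonneg_pos)
  have "t > 0" using e pos by (simp add: t_def)
  have "t * (norm v + norm w) \<le> t * (norm v + norm w + 1)" using \<open>t > 0\<close> by simp
  also have "\<dots> = e / 2" using pos by (simp add: t_def field_simps)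
  also have "\<dots> < e" using e by simp
  finally have te: "t * (norm v + norm w) < e" .
  then have te': "t * (norm w + norm v) < e" by (simp add: add.commute)
  obtain z where z: "dist z x \<le> t * (norm v + norm w)"
    "f (x + t *\<^sub>R v + t *\<^sub>R w) - f (x + t *\<^sub>R v) - f (x + t *\<^sub>R w) + f x = t\<^sup>2 * dd w (dd v f) z"
    using mixed_difference[OF e(2) f \<open>t > 0\<close> te] by blast
  obtain y where y: "dist y x \<le> t * (norm w + norm v)"
    "f (x + t *\<^sub>R w + t *\<^sub>R v) - f (x + t *\<^sub>R w) - f (x + t *\<^sub>R v) + f x = t\<^sup>2 * dd v (dd w f) y"
    using mixed_difference[OF e(2) f \<open>t > 0\<close> te'] by blast
  have "t\<^sup>2 * dd w (dd v f) z = t\<^sup>2 * dd v (dd w f) y"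
    using z(2) y(2) by (simp add: algebra_simps)
  then have "dd w (dd v f) z = dd v (dd w f) y" using \<open>t > 0\<close> by simp
  moreover have "dist (dd w (dd v f) z) (dd w (dd v f) x) < \<delta>" using z(1) te by (intro e1) (simp add: e_def)
  moreover have "dist (dd v (dd w f) y) (dd v (dd w f) x) < \<delta>" using y(1) te' by (intro e2) (simp add: e_def)
  ultimately show False by (simp add: \<delta>_def dist_real_def abs_if field_simps split: if_splits)
qed

lemma vector_field_derivative:
  fixes f :: "'a::euclidean_space \<Rightarrow> real"
  assumes U: "open U" "x \<in> U" and f: "Ck_on 2 U f" and T: "linear T"
  shows "dd s (\<lambda>y. dd (T y) f y) x = dd (T s) f x + dd s (dd (T x) f) x"
proof -
  have fd: "f differentiable (at y)" and fvd: "(dd v f) differentiable (at y)" if "y \<in> U" for y v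
    using f that by (auto simp: numeral_2_eq_2)
  have bT: "bounded_linear (\<lambda>x. T x \<bullet> b)" for b
    using bounded_linear_compose[OF bounded_linear_inner_left linear_conv_bounded_linear[THEN iffD1, OF T]] .
  have bd: "(dd b f has_derivative (\<lambda>s. dd s (dd b f) x)) (at x)" for b
    using fvd[OF U(2)] frechet_derivative_works by blast
  have "dd s (\<lambda>y. dd (T y) f y) x = dd s (\<lambda>y. \<Sum>b\<in>Basis. (T y \<bullet> b) * dd b f y) x"
    by (rule dd_cong(2)[OF U], rule dd_expand[OF fd])
  also have "\<dots> = (\<Sum>b\<in>Basis. (T x \<bullet> b) * dd s (dd b f) x + (T s \<bullet> b) * dd b f x)"
    by (rule dd_eqI) (intro has_derivative_sum has_derivative_mult bounded_linear_imp_has_derivative[OF bT] bd)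
  also have "\<dots> = (\<Sum>b\<in>Basis. (T x \<bullet> b) * dd s (dd b f) x) + dd (T s) f x"
    by (simp add: sum.distrib dd_expand[OF fd[OF U(2)], of "T s"])
  also have "(\<Sum>b\<in>Basis. (T x \<bullet> b) * dd s (dd b f) x) = dd s (\<lambda>y. \<Sum>b\<in>Basis. (T x \<bullet> b) * dd b f y) x"
    by (rule sym, rule dd_eqI) (intro has_derivative_sum has_derivative_mult_right bd)
  also have "\<dots> = dd s (dd (T x) f) x"
    by (rule dd_cong(2)[OF U], rule dd_expand[OF fd, symmetric])
  finally show ?thesis by simp
qed

text \<open>
  The formula \<open>[S, T] f = S (T f) - T (S f)\<close> for vector fields with linear coefficients, the case
  needed for left invariant fields on a matrix group.
\<close>

lemma linear_fields_commutator:
  fixes f :: "'a::euclidean_space \<Rightarrow> real"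
  assumes U: "open U" "x \<in> U" and f: "Ck_on 2 U f" and ST: "linear S" "linear T"
  shows "dd (S x) (\<lambda>y. dd (T y) f y) x - dd (T x) (\<lambda>y. dd (S y) f y) x = dd (T (S x) - S (T x)) f x"
proof -
  have "f differentiable (at x)" using f U by (auto simp: numeral_2_eq_2)
  then show ?thesis
    unfolding vector_field_derivative[OF U f ST(1)] vector_field_derivative[OF U f ST(2)]
    by (simp add: second_derivative_symmetric[OF U f, of "S x" "T x"] linear_diff[OF dd_linear])
qed

section \<open>Left invariant fields on the group\<close>

definition SU2xR :: "((complex^2^2) \<times> real) monoid" where "SU2xR = SU2 \<times>\<times> pos_reals"
abbreviation M :: "((complex^2^2) \<times> real) set" where "M \<equiv> carrier SU2xR"
abbreviation e0 :: "(complex^2^2) \<times> real" where "e0 \<equiv> (mat 1, 1)"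

text \<open>
  The group product, extended to the ambient space, where it is bilinear. Left translations and left
  invariant fields are restrictions of linear maps, which makes their differentials explicit.
\<close>

definition mul :: "(complex^2^2) \<times> real \<Rightarrow> (complex^2^2) \<times> real \<Rightarrow> (complex^2^2) \<times> real" where
  "mul a b = (fst a ** fst b, snd a * snd b)"

lemma SU2xR_simps: "a \<otimes>\<^bsub>SU2xR\<^esub> b = mul a b" "\<one>\<^bsub>SU2xR\<^esub> = e0" "p \<in> M \<longleftrightarrow> fst p \<in> carrier SU2 \<and> snd p > 0"
  by (auto simp: SU2xR_def DirProd_def SU2_def pos_reals_def mul_def mem_Times_iff split: prod.splits)

lemma group_SU2xR: "group SU2xR"
  unfolding SU2xR_def by (rule group_SU2_pos_reals)

lemma e0_in: "e0 \<in> M"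
  using monoid.one_closed[OF group.is_monoid[OF group_SU2xR]] unfolding SU2xR_simps(2) .

lemma mul_in: "a \<in> M \<Longrightarrow> b \<in> M \<Longrightarrow> mul a b \<in> M"
  using monoid.m_closed[OF group.is_monoid[OF group_SU2xR], of a b] unfolding SU2xR_simps(1) .

lemma mul_e0 [simp]: "mul e0 a = a" "mul a e0 = a"
  by (simp_all add: mul_def)

lemma mul_assoc: "mul (mul a b) c = mul a (mul b c)"
  by (simp add: mul_def matrix_mul_assoc mult.assoc)

lemma scaleR_matrix_mult: "(r *\<^sub>R A) ** B = r *\<^sub>R (A ** B)" "A ** (r *\<^sub>R B) = r *\<^sub>R (A ** B)"
  for A B :: "complex^2^2"
  by (simp_all add: matrix_matrix_mult_def vec_eq_iff scaleR_sum_right)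

lemma matrix_add_mult: "(A + B) ** C = A ** C + B ** C" for A B C :: "complex^2^2"
  by (simp add: matrix_matrix_mult_def vec_eq_iff sum.distrib distrib_right)

lemma linear_mul: "linear (mul a)" "linear (\<lambda>x. mul x a)"
  by (auto intro!: linearI simp: mul_def matrix_add_ldistrib matrix_add_mult scaleR_matrix_mult algebra_simps)

lemma bounded_linear_mul: "bounded_linear (mul a)" "bounded_linear (\<lambda>x. mul x a)"
  using linear_mul by (simp_all add: linear_conv_bounded_linear)

text \<open>
  Coordinates of the tangent space at the identity. The factor \<open>1/2\<close> turns the commutators of the
  Pauli type matrices into the cross product.
\<close>

definition coord :: "real^4 \<Rightarrow> (complex^2^2) \<times> real" where
  "coord z = ((1/2) *\<^sub>R vector [vector [Complex 0 (z$1), Complex (z$2) (z$3)], vector [Complex (- (z$2)) (z$3), Complex 0 (- (z$1))]], z$4)"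

lemma vec2: "(vector [a,b] :: 'a^2) $ 1 = a" "(vector [a,b] :: 'a^2) $ 2 = b" for a b :: "'a::zero"
  by (simp_all add: vector_def)

lemma mat2_eq_iff: "(A :: complex^2^2) = B \<longleftrightarrow> A$1$1 = B$1$1 \<and> A$1$2 = B$1$2 \<and> A$2$1 = B$2$1 \<and> A$2$2 = B$2$2"
  by (auto simp: vec_eq_iff forall_2)

lemma coord_nth: "fst (coord z) $ 1 $ 1 = Complex 0 (z$1/2)" "fst (coord z) $ 1 $ 2 = Complex (z$2/2) (z$3/2)"
   "fst (coord z) $ 2 $ 1 = Complex (- (z$2/2)) (z$3/2)" "fst (coord z) $ 2 $ 2 = Complex 0 (- (z$1/2))" "snd (coord z) = z$4"
  by (simp_all add: coord_def vec2 complex_eq_iff)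

lemma linear_coord: "linear coord"
  by (auto intro!: linearI simp: prod_eq_iff mat2_eq_iff coord_nth complex_eq_iff add_divide_distrib)

lemma inj_coord: "coord x = coord y \<Longrightarrow> x = y"
  by (auto simp: prod_eq_iff mat2_eq_iff coord_nth vec4_eq_iff)

lemma coord_bracket: "mul (coord x) (coord y) - mul (coord y) (coord x) = coord (bracket x y)"
  by (simp add: prod_eq_iff mul_def mat2_eq_iff coord_nth matrix_matrix_mult_def sum_2 complex_eq_iff field_simps)

text \<open>
  For determinant \<open>1\<close> the inverse is the adjugate, so \<open>A\<^sup>* = A\<^sup>-\<^sup>1\<close> becomes a linear condition on the
  entries and the equation of a sphere.
\<close>

lemma SU2_iff:
  "A \<in> carrier SU2 \<longleftrightarrow> A$2$2 = cnj (A$1$1) \<and> A$2$1 = - cnj (A$1$2) \<and> (norm (A$1$1))\<^sup>2 + (norm (A$1$2))\<^sup>2 = 1"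
proof -
  define a b c d where abcd: "a = A$1$1" "b = A$1$2" "c = A$2$1" "d = A$2$2"
  have m: "A \<in> carrier SU2 \<longleftrightarrow> a * cnj a + b * cnj b = 1 \<and> a * cnj c + b * cnj d = 0 \<and> c * cnj a + d * cnj b = 0
     \<and> c * cnj c + d * cnj d = 1 \<and> a * d - b * c = 1"
    by (simp add: SU2_def abcd conj_transpose_def mat2_eq_iff matrix_matrix_mult_def sum_2 det_2 mat_def)
  have n: "(norm a)\<^sup>2 + (norm b)\<^sup>2 = 1 \<longleftrightarrow> a * cnj a + b * cnj b = 1"
    unfolding complex_norm_square[symmetric] by (metis of_real_add of_real_eq_1_iff)
  show ?thesis
  proof
    assume "A \<in> carrier SU2"
    then have r: "a * cnj a + b * cnj b = 1" "a * cnj c + b * cnj d = 0" "a * d - b * c = 1" using m by auto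
    have rc: "cnj a * cnj d - cnj b * cnj c = 1" using arg_cong[OF r(3), of cnj] by simp
    have "a - cnj d = a * (cnj a * cnj d - cnj b * cnj c) - cnj d * (a * cnj a + b * cnj b)" using rc r(1) by simp
    also have "\<dots> = - cnj b * (a * cnj c + b * cnj d)" by (simp add: algebra_simps)
    finally have "a = cnj d" using r(2) by simp
    have "b + cnj c = b * (cnj a * cnj d - cnj b * cnj c) + cnj c * (a * cnj a + b * cnj b)" using rc r(1) by simp
    also have "\<dots> = cnj a * (a * cnj c + b * cnj d)" by (simp add: algebra_simps)
    finally have "b = - cnj c" using r(2) by (simp add: eq_neg_iff_add_eq_0)
    show "A$2$2 = cnj (A$1$1) \<and> A$2$1 = - cnj (A$1$2) \<and> (norm (A$1$1))\<^sup>2 + (norm (A$1$2))\<^sup>2 = 1"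
      using n r(1) \<open>a = cnj d\<close> \<open>b = - cnj c\<close> unfolding abcd by simp
  next
    assume "A$2$2 = cnj (A$1$1) \<and> A$2$1 = - cnj (A$1$2) \<and> (norm (A$1$1))\<^sup>2 + (norm (A$1$2))\<^sup>2 = 1"
    then have "d = cnj a" "c = - cnj b" "a * cnj a + b * cnj b = 1" using n abcd by auto
    then show "A \<in> carrier SU2" unfolding m by (simp add: algebra_simps)
  qed
qed

text \<open>
  A curve through the identity with velocity \<open>B \<in> su(2)\<close> is \<open>1 + t B\<close>, scaled back to determinant \<open>1\<close>.
\<close>

lemma coord_in_tangent_space:
  assumes p: "p \<in> M" shows "mul p (coord z) \<in> tangent_space M p"
proof -
  define n2 where "n2 = ((z$1)\<^sup>2 + (z$2)\<^sup>2 + (z$3)\<^sup>2) / 4"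
  define c0 where "c0 t = ((1 / sqrt (1 + n2 * t\<^sup>2)) *\<^sub>R (mat 1 + t *\<^sub>R fst (coord z)), exp (t * z$4))" for t
  have pos: "1 + n2 * t\<^sup>2 > 0" for t by (simp add: n2_def add_pos_nonneg)
  have c0_in: "c0 t \<in> M" for t
  proof -
    have "fst (c0 t) $1$1 = (1 / sqrt (1 + n2 * t\<^sup>2)) *\<^sub>R Complex 1 (t * z$1 / 2)"
      "fst (c0 t) $1$2 = (1 / sqrt (1 + n2 * t\<^sup>2)) *\<^sub>R Complex (t * z$2 / 2) (t * z$3 / 2)"
      by (simp_all add: c0_def coord_nth mat_def complex_eq_iff)
    then have "(norm (fst (c0 t) $1$1))\<^sup>2 + (norm (fst (c0 t) $1$2))\<^sup>2
        = (1 / sqrt (1 + n2 * t\<^sup>2))\<^sup>2 * (1 + n2 * t\<^sup>2)"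
      by (simp only: norm_scaleR power_mult_distrib power2_abs cmod_power2 complex.sel)
        (simp add: n2_def algebra_simps power2_eq_square add_divide_distrib)
    also have "\<dots> = 1" using pos[of t] by (simp add: power_divide)
    finally have "fst (c0 t) \<in> carrier SU2"
      unfolding SU2_iff by (simp add: c0_def coord_nth mat_def complex_eq_iff)
    then show ?thesis by (simp add: SU2xR_simps c0_def)
  qed
  have "((\<lambda>t. 1 / sqrt (1 + n2 * t\<^sup>2)) has_real_derivative 0) (at 0)"
    by (auto intro!: derivative_eq_intros)
  then have "((\<lambda>t. (1 / sqrt (1 + n2 * t\<^sup>2)) *\<^sub>R (mat 1 + t *\<^sub>R fst (coord z))) has_vector_derivative fst (coord z)) (at 0)"
    by (auto intro!: derivative_eq_intros simp: has_real_derivative_iff_has_vector_derivative)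
  moreover have "((\<lambda>t. exp (t * z$4)) has_real_derivative z$4) (at 0)"
    by (auto intro!: derivative_eq_intros)
  then have "((\<lambda>t. exp (t * z$4)) has_vector_derivative snd (coord z)) (at 0)"
    by (simp add: has_real_derivative_iff_has_vector_derivative coord_nth)
  ultimately have "(c0 has_vector_derivative (fst (coord z), snd (coord z))) (at 0)"
    unfolding c0_def by (rule has_vector_derivative_Pair)
  then have "(c0 has_vector_derivative coord z) (at 0)" by simp
  then have "((\<lambda>t. mul p (c0 t)) has_vector_derivative mul p (coord z)) (at 0)"
    by (rule bounded_linear.has_vector_derivative[OF bounded_linear_mul(1)])
  moreover have "c0 0 = e0" by (simp add: c0_def)
  ultimately have "curve_through M p (mul p (coord z)) (\<lambda>t. mul p (c0 t))"
    using p mul_in c0_in by (simp add: curve_through_def)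
  then show ?thesis by (auto simp: tangent_space_def)
qed

text \<open>
  The two linear conditions of \<open>SU2_iff\<close> pass to the velocity \<open>v\<close> of a curve through the
  identity, and the equation of the sphere contributes \<open>Re (fst v $ 1 $ 1) = 0\<close>.
\<close>

lemma tangent_space_e0:
  assumes "v \<in> tangent_space M e0" obtains z where "v = coord z"
proof -
  obtain c where c: "\<And>t. c t \<in> M" "c 0 = e0" "(c has_vector_derivative v) (at 0)"
    using assms by (auto simp: tangent_space_def curve_through_def)
  have lin0: "l v = 0" if "bounded_linear l" "\<And>p. p \<in> M \<Longrightarrow> l p = 0" for l :: "_ \<Rightarrow> complex"
  proof -
    have "((\<lambda>t. l (c t)) has_vector_derivative l v) (at 0)"
      using bounded_linear.has_vector_derivative[OF that(1) c(3)] .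
    moreover have "(\<lambda>t. l (c t)) = (\<lambda>_. 0)" using that(2) c(1) by auto
    ultimately have "((\<lambda>_. 0) has_vector_derivative l v) (at 0)" by simp
    then show ?thesis by (rule vector_derivative_unique_at) (rule has_vector_derivative_const)
  qed
  have bl: "bounded_linear (\<lambda>p :: (complex^2^2) \<times> real. fst p $ i $ j)" for i j
    by (intro bounded_linear_compose[OF bounded_linear_vec_nth] bounded_linear_fst)
  have blc: "bounded_linear (\<lambda>p :: (complex^2^2) \<times> real. cnj (fst p $ i $ j))" for i j
    by (rule bounded_linear_compose[OF bounded_linear_cnj bl])
  have 1: "fst v $ 2 $ 2 - cnj (fst v $ 1 $ 1) = 0"
    by (rule lin0) (auto intro!: bounded_linear_sub bl blc simp: SU2xR_simps SU2_iff)
  have 2: "fst v $ 2 $ 1 + cnj (fst v $ 1 $ 2) = 0"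
    by (rule lin0) (auto intro!: bounded_linear_add bl blc simp: SU2xR_simps SU2_iff)
  have d: "((\<lambda>t. fst (c t) $ i $ j) has_vector_derivative fst v $ i $ j) (at 0)" for i j
    using bounded_linear.has_vector_derivative[OF bl c(3)] .
  have di: "((\<lambda>t. fst (c t) $ i $ j \<bullet> fst (c t) $ i $ j) has_vector_derivative
      2 * (fst e0 $ i $ j \<bullet> fst v $ i $ j)) (at 0)" for i j
    using bounded_bilinear.has_vector_derivative[OF bounded_bilinear_inner d[of i j] d[of i j]] c(2) by (simp add: inner_commute)
  have "((\<lambda>t. fst (c t) $ 1 $ 1 \<bullet> fst (c t) $ 1 $ 1 + fst (c t) $ 1 $ 2 \<bullet> fst (c t) $ 1 $ 2) has_vector_derivative
      2 * (fst e0 $ 1 $ 1 \<bullet> fst v $ 1 $ 1) + 2 * (fst e0 $ 1 $ 2 \<bullet> fst v $ 1 $ 2)) (at 0)"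
    by (intro has_vector_derivative_add di)
  moreover have "(\<lambda>t. fst (c t) $ 1 $ 1 \<bullet> fst (c t) $ 1 $ 1 + fst (c t) $ 1 $ 2 \<bullet> fst (c t) $ 1 $ 2) = (\<lambda>_. 1)"
    using c(1) by (auto simp: SU2xR_simps SU2_iff simp flip: power2_norm_eq_inner)
  ultimately have "((\<lambda>_. 1) has_vector_derivative
      2 * (fst e0 $ 1 $ 1 \<bullet> fst v $ 1 $ 1) + 2 * (fst e0 $ 1 $ 2 \<bullet> fst v $ 1 $ 2)) (at 0)" by simp
  then have "2 * (fst e0 $ 1 $ 1 \<bullet> fst v $ 1 $ 1) + 2 * (fst e0 $ 1 $ 2 \<bullet> fst v $ 1 $ 2) = 0"
    by (rule vector_derivative_unique_at) (rule has_vector_derivative_const)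
  then have 3: "Re (fst v $ 1 $ 1) = 0" by (simp add: mat_def inner_complex_def)
  have "v = coord (vector [2 * Im (fst v $1$1), 2 * Re (fst v $1$2), 2 * Im (fst v $1$2), snd v])"
    using 1 2 3 by (auto simp: prod_eq_iff mat2_eq_iff coord_nth vector_def complex_eq_iff)
  then show ?thesis using that by blast
qed

lemma tderiv_linear:
  assumes "v \<in> tangent_space M p" "linear F" "\<And>x. x \<in> M \<Longrightarrow> f x = F x"
  shows "tderiv M f p v = F v"
proof -
  have F: "(F has_derivative F) (at p)"
    using assms(2) by (simp add: linear_imp_has_derivative)
  then have "F differentiable (at p)" by (auto simp: differentiable_def)
  from tderiv_eq[OF assms(1) open_UNIV UNIV_I this] assms(3)
  show ?thesis using dd_eqI[OF F] by simp
qed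

text \<open>
  The left invariant field with value \<open>coord z\<close> at the identity, set to \<open>0\<close> off the group as in
  \<open>vector_fields\<close>.
\<close>

definition left_field :: "real^4 \<Rightarrow> (complex^2^2) \<times> real \<Rightarrow> (complex^2^2) \<times> real" where
  "left_field z p = (if p \<in> M then mul p (coord z) else 0)"

lemma left_field_in: "p \<in> M \<Longrightarrow> left_field z p \<in> tangent_space M p"
  by (simp add: left_field_def coord_in_tangent_space)

lemma smooth_map_const: "smooth_map S (\<lambda>_. c)"
  unfolding smooth_map_def by (auto intro!: exI[of _ UNIV] exI[of _ "\<lambda>_. c"] Ck_on_const)

lemma left_field_vector_field: "left_field z \<in> vector_fields M"
proof -
  have "smooth_map M (left_field z)"
    unfolding smooth_map_def
    by (auto intro!: exI[of _ UNIV] exI[of _ "\<lambda>x. mul x (coord z)"] Ck_on_linear bounded_linear_mul simp: left_field_def)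
  then show ?thesis using left_field_in by (auto simp: vector_fields_def) (auto simp: left_field_def)
qed

lemma left_field_add: "left_field (y + z) = (\<lambda>p. left_field y p + left_field z p)"
  by (auto simp: left_field_def linear_add[OF linear_coord] linear_add[OF linear_mul(1)])

lemma left_field_scale: "left_field (r *\<^sub>R z) = (\<lambda>p. r *\<^sub>R left_field z p)"
  by (auto simp: left_field_def linear_scale[OF linear_coord] linear_scale[OF linear_mul(1)])

lemma left_field_e0: "left_field z e0 = coord z"
  by (simp add: left_field_def e0_in)

lemma dL_eq: "a \<in> M \<Longrightarrow> p \<in> M \<Longrightarrow> v \<in> tangent_space M p \<Longrightarrow> dL SU2xR a p v = mul a v"
  unfolding dL_def by (intro tderiv_linear linear_mul) (simp_all add: SU2xR_simps)

lemma inv_in: "a \<in> M \<Longrightarrow> inv\<^bsub>SU2xR\<^esub> a \<in> M"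
  using group.inv_closed[OF group_SU2xR] .

lemma mul_inv: "a \<in> M \<Longrightarrow> mul a (inv\<^bsub>SU2xR\<^esub> a) = e0" "a \<in> M \<Longrightarrow> mul (inv\<^bsub>SU2xR\<^esub> a) a = e0"
  using group.r_inv[OF group_SU2xR, of a] group.l_inv[OF group_SU2xR, of a] by (simp_all add: SU2xR_simps(1,2))

lemma L_push_left_field: "a \<in> M \<Longrightarrow> L_push SU2xR a (left_field z) = left_field z"
proof (rule ext)
  fix p assume a: "a \<in> M"
  show "L_push SU2xR a (left_field z) p = left_field z p"
  proof (cases "p \<in> M")
    case True
    have q: "mul (inv\<^bsub>SU2xR\<^esub> a) p \<in> M" using a True inv_in mul_in by blast
    have "L_push SU2xR a (left_field z) p = mul a (left_field z (mul (inv\<^bsub>SU2xR\<^esub> a) p))"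
      using True by (simp add: L_push_def SU2xR_simps(1) dL_eq[OF a q left_field_in[OF q]])
    also have "\<dots> = mul (mul (mul a (inv\<^bsub>SU2xR\<^esub> a)) p) (coord z)" using q by (simp add: left_field_def mul_assoc)
    finally show ?thesis using True a by (simp add: mul_inv left_field_def)
  qed (simp add: L_push_def left_field_def)
qed

lemma lie_bracket_left_field: "lie_bracket M (left_field y) (left_field z) = left_field (bracket y z)"
proof (rule ext)
  fix p
  show "lie_bracket M (left_field y) (left_field z) p = left_field (bracket y z) p"
  proof (cases "p \<in> M")
    case True
    have t: "tderiv M (left_field z) p (left_field y p) = mul (left_field y p) (coord z)" for y z
      by (rule tderiv_linear[OF left_field_in[OF True] linear_mul(2)]) (simp add: left_field_def)
    have "lie_bracket M (left_field y) (left_field z) p = mul (left_field y p) (coord z) - mul (left_field z p) (coord y)"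
      using True by (simp add: lie_bracket_def t)
    also have "\<dots> = mul p (mul (coord y) (coord z) - mul (coord z) (coord y))"
      using True by (simp add: left_field_def mul_assoc linear_diff[OF linear_mul(1)])
    finally show ?thesis using True by (simp add: coord_bracket left_field_def)
  qed (simp add: lie_bracket_def left_field_def)
qed

section \<open>Reduction to the Lie algebra\<close>

text \<open>
  A left invariant connection maps left invariant fields to left invariant fields, so it amounts to
  the product \<open>dot\<close> on \<open>\<real>\<^sup>4\<close>. For a local potential \<open>\<phi>\<close> put \<open>F z = z \<phi>\<close> with \<open>z\<close> as a left invariant
  field. The Hessian condition reads \<open>y (F z) = h y z + F (dot y z)\<close>. Applying it twice to
  \<open>x (y (F z)) - y (x (F z)) = [x, y] (F z)\<close> gives the Codazzi equation, as the terms with \<open>F\<close> cancel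
  by flatness.
\<close>

theorem corollary8p5:
  "\<not> (\<exists>nabla g. hessian_lie_group (SU2 \<times>\<times> pos_reals) nabla g)"
proof
  assume "\<exists>nabla g. hessian_lie_group (SU2 \<times>\<times> pos_reals) nabla g"
  then obtain nabla g where H: "hessian_lie_group SU2xR nabla g" unfolding SU2xR_def by blast
  have conn: "connection M nabla" and flat: "flat M nabla" and tf: "torsion_free M nabla"
    and linv: "left_invariant_connection SU2xR nabla" and lim: "left_invariant_metric SU2xR g"
    and hess: "hessian_metric M nabla g"
    using H by (auto simp: hessian_lie_group_def left_invariant_affine_structure_def)
  have rm: "riemannian_metric M g" using lim by (simp add: left_invariant_metric_def)
  have coord_in: "coord z \<in> tangent_space M e0" for z using coord_in_tangent_space[OF e0_in, of z] by simp

  define dot where "dot y z = (SOME w. nabla (left_field y) (left_field z) e0 = coord w)" for y z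
  have nabla_in: "nabla (left_field y) (left_field z) \<in> vector_fields M" for y z
    using conn left_field_vector_field by (simp add: connection_def)
  have dot0: "nabla (left_field y) (left_field z) e0 = coord (dot y z)" for y z
  proof -
    have "nabla (left_field y) (left_field z) e0 \<in> tangent_space M e0" using nabla_in e0_in by (simp add: vector_fields_def)
    then show ?thesis unfolding dot_def by (metis (mono_tags, lifting) tangent_space_e0 someI)
  qed
  have dot: "nabla (left_field y) (left_field z) = left_field (dot y z)" for y z
  proof
    fix p
    show "nabla (left_field y) (left_field z) p = left_field (dot y z) p"
    proof (cases "p \<in> M")
      case True
      have "nabla (L_push SU2xR p (left_field y)) (L_push SU2xR p (left_field z)) = L_push SU2xR p (nabla (left_field y) (left_field z))"
        using linv True left_field_vector_field unfolding left_invariant_connection_def by blast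
      then have "nabla (left_field y) (left_field z) p = L_push SU2xR p (nabla (left_field y) (left_field z)) p"
        by (simp add: L_push_left_field[OF True])
      also have "\<dots> = mul p (coord (dot y z))"
        using True coord_in by (simp add: L_push_def SU2xR_simps(1) mul_inv dot0 dL_eq e0_in)
      finally show ?thesis using True by (simp add: left_field_def)
    next
      case False
      then show ?thesis using nabla_in[of y z] by (simp add: vector_fields_def left_field_def del: split_paired_All)
    qed
  qed

  have left_field_inj: "y = z" if "left_field y e0 = left_field z e0" for y z using that inj_coord by (simp add: left_field_e0)
  have dot_add: "dot (x + y) z = dot x z + dot y z" "dot z (x + y) = dot z x + dot z y" for x y z
  proof -
    have "left_field (dot (x + y) z) = left_field (dot x z + dot y z)"
      using conn left_field_vector_field unfolding connection_def by (simp add: left_field_add flip: dot)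
    then show "dot (x + y) z = dot x z + dot y z" by (metis left_field_inj)
    have "left_field (dot z (x + y)) = left_field (dot z x + dot z y)"
      using conn left_field_vector_field unfolding connection_def by (simp add: left_field_add flip: dot)
    then show "dot z (x + y) = dot z x + dot z y" by (metis left_field_inj)
  qed
  have dot_scale: "dot (r *\<^sub>R x) z = r *\<^sub>R dot x z" "dot z (r *\<^sub>R x) = r *\<^sub>R dot z x" for r x z
  proof -
    have "nabla (\<lambda>p. r *\<^sub>R left_field x p) (left_field z) = (\<lambda>p. r *\<^sub>R nabla (left_field x) (left_field z) p)"
      by (rule conn[unfolded connection_def, THEN conjunct2, THEN conjunct2, THEN conjunct2, THEN conjunct1,
            rule_format, of "\<lambda>_. r" "left_field x" "left_field z"])
        (intro conjI left_field_vector_field smooth_map_const)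
    then have "left_field (dot (r *\<^sub>R x) z) = left_field (r *\<^sub>R dot x z)"
      by (simp add: left_field_scale flip: dot)
    then show "dot (r *\<^sub>R x) z = r *\<^sub>R dot x z" by (metis left_field_inj)
    have "nabla (left_field z) (\<lambda>p. r *\<^sub>R left_field x p) = (\<lambda>p. vf_apply M (left_field z) (\<lambda>_. r) p *\<^sub>R left_field x p + r *\<^sub>R nabla (left_field z) (left_field x) p)"
      by (rule conn[unfolded connection_def, THEN conjunct2, THEN conjunct2, THEN conjunct2, THEN conjunct2,
            rule_format, of "\<lambda>_. r" "left_field z" "left_field x"])
        (intro conjI left_field_vector_field smooth_map_const)
    then have "nabla (left_field z) (\<lambda>p. r *\<^sub>R left_field x p) e0 = vf_apply M (left_field z) (\<lambda>_. r) e0 *\<^sub>R left_field x e0 + r *\<^sub>R nabla (left_field z) (left_field x) e0"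
      by metis
    moreover have "vf_apply M (left_field z) (\<lambda>_. r) e0 = 0"
      using tderiv_eq[OF left_field_in[OF e0_in] open_UNIV UNIV_I differentiable_const, of "\<lambda>_. r" r z]
      by (simp add: vf_apply_def)
    ultimately have "left_field (dot z (r *\<^sub>R x)) e0 = left_field (r *\<^sub>R dot z x) e0"
      by (simp add: left_field_scale flip: dot)
    then show "dot z (r *\<^sub>R x) = r *\<^sub>R dot z x" by (rule left_field_inj)
  qed
  have torsion: "dot x y - dot y x = bracket x y" for x y
  proof -
    have "nabla (left_field x) (left_field y) e0 - nabla (left_field y) (left_field x) e0 - lie_bracket M (left_field x) (left_field y) e0 = 0"
      using tf left_field_vector_field unfolding torsion_free_def by blast
    then have "coord (dot x y - dot y x) = coord (bracket x y)"
      by (simp add: dot0 lie_bracket_left_field left_field_e0 linear_diff[OF linear_coord])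
    then show ?thesis by (rule inj_coord)
  qed
  have flat': "dot x (dot y z) - dot y (dot x z) = dot (bracket x y) z" for x y z
  proof -
    have "nabla (left_field x) (nabla (left_field y) (left_field z)) e0 - nabla (left_field y) (nabla (left_field x) (left_field z)) e0 - nabla (lie_bracket M (left_field x) (left_field y)) (left_field z) e0 = 0"
      using flat left_field_vector_field unfolding flat_def by blast
    then have "coord (dot x (dot y z) - dot y (dot x z)) = coord (dot (bracket x y) z)"
      by (simp add: dot lie_bracket_left_field left_field_e0 linear_diff[OF linear_coord])
    then show ?thesis by (rule inj_coord)
  qed

  define h where "h x y = g e0 (coord x) (coord y)" for x y
  have g: "g e0 (coord x) (coord y) = g e0 (coord y) (coord x)" "g e0 (coord x + coord y) (coord z) = g e0 (coord x) (coord z) + g e0 (coord y) (coord z)"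
    "g e0 (r *\<^sub>R coord x) (coord y) = r * g e0 (coord x) (coord y)" "coord x \<noteq> 0 \<Longrightarrow> g e0 (coord x) (coord x) > 0" for x y z r
    using rm e0_in coord_in unfolding riemannian_metric_def by blast+
  have hsym: "h x y = h y x" for x y by (simp add: h_def g(1))
  have hl: "h (x + y) z = h x z + h y z" "h (r *\<^sub>R x) y = r * h x y" for x y z r
    by (simp_all add: h_def linear_add[OF linear_coord] linear_scale[OF linear_coord] g(2,3))
  have hr: "h z (x + y) = h z x + h z y" "h y (r *\<^sub>R x) = r * h y x" for x y z r
    by (metis hsym hl(1)) (metis hsym hl(2))
  have hpos: "h x x > 0" if "x \<noteq> 0" for x
    using g(4)[of x] inj_coord[of x 0] that by (auto simp: h_def linear_0[OF linear_coord])
  have h_const: "g p (left_field x p) (left_field y p) = h x y" if p: "p \<in> M" for p x y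
  proof -
    have "g (p \<otimes>\<^bsub>SU2xR\<^esub> e0) (dL SU2xR p e0 (coord x)) (dL SU2xR p e0 (coord y)) = g e0 (coord x) (coord y)"
      using lim p e0_in coord_in unfolding left_invariant_metric_def by blast
    then show ?thesis using p by (simp add: SU2xR_simps(1) dL_eq e0_in coord_in h_def left_field_def)
  qed

  have codazzi: "h (bracket x y) z = h x (dot y z) - h y (dot x z)" for x y z
  proof -
    obtain U phi where U: "open U" "e0 \<in> U" "smooth_map (M \<inter> U) phi"
      and g_hess: "\<forall>Y\<in>vector_fields M. \<forall>Z\<in>vector_fields M. \<forall>q\<in>M \<inter> U. g q (Y q) (Z q) = hessian M nabla phi Y Z q"
      using hess[unfolded hessian_metric_def, THEN conjunct2, THEN bspec, OF e0_in] by (elim exE conjE)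
    obtain U' Phi where U': "open U'" "e0 \<in> U'" "\<And>k. Ck_on k U' Phi" "\<And>x. x \<in> (M \<inter> U) \<inter> U' \<Longrightarrow> phi x = Phi x"
      using U(3)[unfolded smooth_map_def, THEN bspec, of e0] U(2) e0_in by auto
    define W where "W = U \<inter> U'"
    have W: "open W" "e0 \<in> W" using U U' by (auto simp: W_def)
    \<comment> \<open>\<open>F\<close> and \<open>E\<close> are defined near \<open>e0\<close> in the ambient space, where second derivatives make sense.\<close>
    define F where "F z x = dd (mul x (coord z)) Phi x" for z x
    have F_Ck: "Ck_on k U' (F z)" for k z
      unfolding F_def by (rule Ck_on_vector_field[OF U'(1) linear_mul(2) U'(3)])
    have F_diff: "F z differentiable (at q)" and Phi_diff: "Phi differentiable (at q)" if "q \<in> W" for z q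
      using F_Ck[of 1 z] U'(3)[of 1] that by (auto simp: W_def)
    have vf: "vf_apply M (left_field y) f q = dd (mul q (coord y)) f' q"
      if "q \<in> M \<inter> W" "f' differentiable (at q)" "\<And>x. x \<in> M \<inter> W \<Longrightarrow> f x = f' x" for f f' y q
      using tderiv_eq[OF left_field_in[of q y] W(1) _ that(2), of f] that by (simp add: vf_apply_def left_field_def)
    have phi_Phi: "phi x = Phi x" if "x \<in> M \<inter> W" for x using U'(4) that by (auto simp: W_def)
    have vf_phi: "vf_apply M (left_field z) phi q = F z q" if "q \<in> M \<inter> W" for z q
      unfolding F_def using that by (intro vf Phi_diff phi_Phi) auto
    define E where "E y z q = dd (mul q (coord y)) (F z) q" for y z q
    \<comment> \<open>The Hessian condition, where \<open>\<nabla>\<^sub>y z\<close> is the left invariant field of \<open>dot y z\<close>.\<close>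
    have E: "E y z q = h y z + F (dot y z) q" if q: "q \<in> M \<inter> W" for y z q
    proof -
      have "h y z = hessian M nabla phi (left_field y) (left_field z) q"
        using g_hess[THEN bspec, OF left_field_vector_field, THEN bspec, OF left_field_vector_field, THEN bspec, of q y z] h_const[of q y z] q
        by (simp add: W_def)
      also have "\<dots> = E y z q - F (dot y z) q"
        unfolding hessian_def dot E_def using q by (subst vf[OF q F_diff vf_phi]) (auto simp: vf_phi)
      finally show ?thesis by simp
    qed
    have eW: "e0 \<in> M \<inter> W" using W e0_in by simp
    have E_diff: "E y z differentiable (at e0)" for y z
      using Ck_on_vector_field[OF U'(1) linear_mul(2)[of "coord y"] F_Ck[of "Suc 1" z]] U'(2) unfolding E_def by auto
    have dE: "dd (coord x) (E y z) e0 = h x (dot y z) + F (dot x (dot y z)) e0" for x y z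
    proof -
      have d: "((\<lambda>q. h y z + F (dot y z) q) has_derivative (\<lambda>v. dd v (F (dot y z)) e0)) (at e0)"
      proof -
        have "(F (dot y z) has_derivative (\<lambda>v. dd v (F (dot y z)) e0)) (at e0)"
          using F_diff[OF W(2)] frechet_derivative_works by blast
        from has_derivative_add[OF has_derivative_const[of "h y z"] this] show ?thesis by simp
      qed
      have "dd (mul e0 (coord x)) (E y z) e0 = vf_apply M (left_field x) (E y z) e0"
        by (rule vf[OF eW E_diff, symmetric]) simp
      also have "\<dots> = dd (mul e0 (coord x)) (\<lambda>q. h y z + F (dot y z) q) e0"
        using d by (intro vf[OF eW] E) (auto simp: differentiable_def)
      also have "\<dots> = E x (dot y z) e0" unfolding dd_eqI[OF d] E_def by simp
      also have "\<dots> = h x (dot y z) + F (dot x (dot y z)) e0" by (rule E[OF eW])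
      finally show ?thesis by simp
    qed
    have F_lin: "F (x - y) e0 = F x e0 - F y e0" for x y
      by (simp add: F_def linear_diff[OF linear_coord] linear_diff[OF dd_linear[OF Phi_diff[OF W(2)]]])
    have "dd (mul e0 (coord x)) (E y z) e0 - dd (mul e0 (coord y)) (E x z) e0
        = dd (mul (mul e0 (coord x)) (coord y) - mul (mul e0 (coord y)) (coord x)) (F z) e0"
      unfolding E_def by (rule linear_fields_commutator[OF U'(1,2) F_Ck linear_mul(2) linear_mul(2)])
    then have "dd (coord x) (E y z) e0 - dd (coord y) (E x z) e0 = E (bracket x y) z e0"
      by (simp add: coord_bracket E_def)
    also have "\<dots> = h (bracket x y) z + F (dot (bracket x y) z) e0" by (rule E[OF eW])
    finally show ?thesis unfolding dE flat'[symmetric] F_lin by simp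
  qed

  have "bilinear dot"
    unfolding bilinear_def by (auto intro!: linearI simp: dot_add dot_scale)
  moreover have "bilinear h"
    unfolding bilinear_def by (auto intro!: linearI simp: hl hr)
  ultimately interpret hessian_algebra dot h
    using hsym hpos torsion flat' codazzi by unfold_locales auto
  show False by (rule no_hessian_algebra)
qed

end
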